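(* Let $b>0$, $T>0$, $0\le\alpha<1$, $\beta>0$, $c>0$, and let $X(\cdot)$ be the solution $$X(t)=X_0e^{-bt}+\int_0^te^{-b(t-s)}\,dL(s)$$ of the OU-CTS equation $dX(t)=-bX(t)\,dt+dL(t)$ with $X(0)=X_0$ a.s., where $L(\cdot)$ is a Lévy process, independent of $X_0$, such that $L(T)$ has law $\mathcal{CTS}(\alpha,\beta,c)$. Then at every $t>0$, with $a=e^{-bt}$, $X(t)$ is in distribution the sum of three independent random variables $$X(t)\stackrel{d}{=}aX_0+X_1+X_2,$$ where $X_1$ is distributed according to the law $\mathcal{CTS}\left(\alpha,\frac{\beta}{a},c\,\frac{1-a^\alpha}{T\alpha b}\right)$, while $$X_2=\sum_{k=1}^{N_a}J_k$$ is a compound Poisson random variable, where $N_a$ is an independent Poisson random variable with parameter $$\Lambda_a=\frac{c\,\beta^\alpha\,\Gamma(1-\alpha)}{Tb\,\alpha^2a^\alpha}\left(1-a^\alpha+a^\alpha\log a^\alpha\right)$$ and $J_k$ are i.i.d. random variables with probability density $$f_J(x)=\frac{\alpha\,a^\alpha}{1-a^\alpha+a^\alpha\log a^\alpha}\int_1^{\frac1a}\frac{x^{-\alpha}(\beta v)^{1-\alpha}e^{-\beta v x}}{\Gamma(1-\alpha)}\,\frac{v^\alpha-1}{v}\,dv,\qquad x>0.$$ For $\alpha=0$ the expressions $\frac{1-a^\alpha}{\alpha}$, $\Lambda_a$ and $f_J$ are understood as their limits for $\alpha\to0^+$.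
   Context: $\mathcal{CTS}(\alpha,\beta,c)$ (classical tempered stable law), with $0\le\alpha<1$, $\beta>0$, $c>0$, denotes the infinitely divisible law on $[0,+\infty)$ without drift and Gaussian part, with Lévy density $\nu(x)=c\,e^{-\beta x}/x^{1+\alpha}$ for $x>0$ and $\nu(x)=0$ for $x<0$; that is, with characteristic function $\exp\left(\int_0^{+\infty}(e^{iux}-1)\,c\,e^{-\beta x}x^{-1-\alpha}dx\right)$. The constant $T>0$ is a fixed arbitrary time scale: the Lévy process $L(\cdot)$ is the one for which the characteristic function of $L(t)$ is $\varphi_L(u)^{t/T}$, with $\varphi_L$ the characteristic function of $\mathcal{CTS}(\alpha,\beta,c)$. *)

theory Defs
  imports "HOL-Probability.Probability"
begin

section \<open>Independence of two random elements\<close>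

text \<open>\<open>prob_space.indep_var\<close> forces both random elements to take values in the same type.\<close>

definition indep_rv ::
    "'a measure \<Rightarrow> 'b measure \<Rightarrow> ('a \<Rightarrow> 'b) \<Rightarrow> 'c measure \<Rightarrow> ('a \<Rightarrow> 'c) \<Rightarrow> bool" where
  "indep_rv M A X B Y \<longleftrightarrow>
     X \<in> measurable M A \<and> Y \<in> measurable M B \<and>
     prob_space.indep_set M (sets (vimage_algebra (space M) X A)) (sets (vimage_algebra (space M) Y B))"


section \<open>Levy processes and integrals against them\<close>

text \<open>
  The time parameter ranges over the nonnegative reals; values \<open>L t\<close> with \<open>t < 0\<close> are
  irrelevant. The definition is that of Sato, including the right-continuity of the paths with
  left limits.
\<close>

definition levy_process :: "'a measure \<Rightarrow> (real \<Rightarrow> 'a \<Rightarrow> real) \<Rightarrow> bool" where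
  "levy_process M L \<longleftrightarrow>
     prob_space M \<and>
     (\<forall>t\<ge>0. L t \<in> borel_measurable M) \<and>
     (AE \<omega> in M. L 0 \<omega> = 0) \<and>
     (\<forall>(\<tau> :: nat \<Rightarrow> real) n. 0 \<le> \<tau> 0 \<longrightarrow> (\<forall>i<n. \<tau> i \<le> \<tau> (Suc i)) \<longrightarrow>
        prob_space.indep_vars M (\<lambda>_. borel) (\<lambda>i \<omega>. L (\<tau> (Suc i)) \<omega> - L (\<tau> i) \<omega>) {..<n}) \<and>
     (\<forall>s\<ge>0. \<forall>h\<ge>0. distr M borel (\<lambda>\<omega>. L (s + h) \<omega> - L s \<omega>) = distr M borel (L h)) \<and>
     (\<forall>t\<ge>0. \<forall>\<epsilon>>0.
        ((\<lambda>s. measure M {\<omega> \<in> space M. \<bar>L s \<omega> - L t \<omega>\<bar> > \<epsilon>}) \<longlongrightarrow> 0) (at t within {0..})) \<and>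
     (AE \<omega> in M. (\<forall>t\<ge>0. continuous (at_right t) (\<lambda>s. L s \<omega>)) \<and>
                 (\<forall>t>0. \<exists>l. ((\<lambda>s. L s \<omega>) \<longlongrightarrow> l) (at_left t)))"

text \<open>
  The integral of a deterministic function over \<open>(0, t]\<close> against \<open>L\<close>, for \<open>L\<close> with nondecreasing
  right-continuous paths: the pathwise Lebesgue-Stieltjes integral. Without monotonicity of the
  path the value has no meaning. For a Levy process with nonnegative increments, such as one with
  CTS marginals, almost every path is nondecreasing and right-continuous. The path is extended
  by \<open>L 0\<close> to negative times, because \<open>interval_measure\<close> expects a function on the whole line.
\<close>

definition stieltjes_integral ::
    "(real \<Rightarrow> 'a \<Rightarrow> real) \<Rightarrow> (real \<Rightarrow> real) \<Rightarrow> real \<Rightarrow> 'a \<Rightarrow> real" where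
  "stieltjes_integral L f t \<omega> =
     set_lebesgue_integral (interval_measure (\<lambda>s. L (max 0 s) \<omega>)) {0<..t} f"

definition OU_solution ::
    "'a measure \<Rightarrow> real \<Rightarrow> ('a \<Rightarrow> real) \<Rightarrow> (real \<Rightarrow> 'a \<Rightarrow> real) \<Rightarrow> (real \<Rightarrow> 'a \<Rightarrow> real) \<Rightarrow> bool" where
  "OU_solution M b X0 L X \<longleftrightarrow>
     (\<forall>t\<ge>0. X t \<in> borel_measurable M \<and>
        (AE \<omega> in M. X t \<omega> = X0 \<omega> * exp (- b * t)
                      + stieltjes_integral L (\<lambda>s. exp (- b * (t - s))) t \<omega>))"


section \<open>Classical tempered stable laws\<close>

definition cts_levy_density :: "real \<Rightarrow> real \<Rightarrow> real \<Rightarrow> real \<Rightarrow> real" where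
  "cts_levy_density \<alpha> \<beta> c x = (if x > 0 then c * exp (- \<beta> * x) / x powr (1 + \<alpha>) else 0)"

definition cts_law :: "real \<Rightarrow> real \<Rightarrow> real \<Rightarrow> real measure \<Rightarrow> bool" where
  "cts_law \<alpha> \<beta> c \<mu> \<longleftrightarrow>
     0 \<le> \<alpha> \<and> \<alpha> < 1 \<and> \<beta> > 0 \<and> c > 0 \<and> real_distribution \<mu> \<and>
     (\<forall>u. char \<mu> u =
        exp (CLINT x|lborel. (iexp (u * x) - 1) * complex_of_real (cts_levy_density \<alpha> \<beta> c x)))"


section \<open>Compound Poisson random variables\<close>

text \<open>\<open>\<lambda>\<close> must be positive: \<open>poisson_pmf\<close> is unspecified otherwise.\<close>

definition compound_poisson ::
    "'a measure \<Rightarrow> real \<Rightarrow> (real \<Rightarrow> real) \<Rightarrow> ('a \<Rightarrow> nat) \<Rightarrow> (nat \<Rightarrow> 'a \<Rightarrow> real) \<Rightarrow> ('a \<Rightarrow> real) \<Rightarrow> bool"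
where
  "compound_poisson M \<Lambda> f N J Y \<longleftrightarrow>
     \<Lambda> > 0 \<and>
     N \<in> measurable M (count_space UNIV) \<and>
     distr M (count_space UNIV) N = measure_pmf (poisson_pmf \<Lambda>) \<and>
     prob_space.indep_vars M (\<lambda>_. borel) J {1..} \<and>
     (\<forall>k\<ge>1. distributed M lborel (J k) (\<lambda>x. ennreal (f x))) \<and>
     indep_rv M (count_space UNIV) N
        (Pi\<^sub>M {1..} (\<lambda>_. borel)) (\<lambda>\<omega>. \<lambda>k\<in>{1..}. J k \<omega>) \<and>
     (\<forall>\<omega>\<in>space M. Y \<omega> = (\<Sum>k=1..N \<omega>. J k \<omega>))"


section \<open>The parameters of the decomposition\<close>

definition ext_at_0 :: "(real \<Rightarrow> real) \<Rightarrow> real \<Rightarrow> real" where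
  "ext_at_0 g \<alpha> = (if \<alpha> = 0 then Lim (at_right 0) g else g \<alpha>)"

definition OU_CTS_factor :: "real \<Rightarrow> real \<Rightarrow> real" where
  "OU_CTS_factor a = ext_at_0 (\<lambda>\<alpha>. (1 - a powr \<alpha>) / \<alpha>)"

definition OU_CTS_rate :: "real \<Rightarrow> real \<Rightarrow> real \<Rightarrow> real \<Rightarrow> real \<Rightarrow> real \<Rightarrow> real" where
  "OU_CTS_rate T b \<beta> c a = ext_at_0 (\<lambda>\<alpha>.
     c * \<beta> powr \<alpha> * Gamma (1 - \<alpha>) / (T * b * \<alpha>\<^sup>2 * a powr \<alpha>)
       * (1 - a powr \<alpha> + a powr \<alpha> * ln (a powr \<alpha>)))"

definition OU_CTS_jump_density :: "real \<Rightarrow> real \<Rightarrow> real \<Rightarrow> real \<Rightarrow> real" where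
  "OU_CTS_jump_density \<beta> a \<alpha> x =
     (if x > 0 then
        ext_at_0 (\<lambda>\<alpha>.
          \<alpha> * a powr \<alpha> / (1 - a powr \<alpha> + a powr \<alpha> * ln (a powr \<alpha>))
          * set_lebesgue_integral lborel {1..1/a}
              (\<lambda>v. x powr (- \<alpha>) * (\<beta> * v) powr (1 - \<alpha>) * exp (- \<beta> * v * x) / Gamma (1 - \<alpha>)
                    * ((v powr \<alpha> - 1) / v))) \<alpha>
      else 0)"

end

theory Submission
  imports Defs
begin

text \<open>
  The laws are compared through their characteristic functions, which determine them. Write \<open>\<psi>\<close> for
  the Levy exponent of the law of \<open>L T\<close>. Almost every path of \<open>L\<close> is nondecreasing, because a
  tempered stable law lives on the half line (\<open>cts_law_nonneg\<close>,
  \<open>levy_process_nondecreasing_paths\<close>), and so the integral in the solution is a limit of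
  Riemann-Stieltjes sums, that is, of weighted sums of independent increments. Each increment has
  an exponent proportional to \<open>\<psi>\<close> (\<open>levy_process_char\<close>). Together with the independence of \<open>X0\<close>
  from \<open>L\<close> this gives (\<open>OU_solution_char\<close>) the characteristic function of \<open>X t\<close>: it is that of
  \<open>a * X0\<close> times the exponential of the integral of \<open>\<psi> (u * exp (- b * (t - s))) / T\<close> over
  \<open>0 \<le> s \<le> t\<close>.

  It remains to read this time integral as a Levy exponent. Contracting a jump by the factor \<open>1 / v\<close>
  replaces \<open>\<beta>\<close> by \<open>\<beta> * v\<close> and \<open>c\<close> by \<open>c * v powr - \<alpha>\<close>; with \<open>v = exp (b * (t - s))\<close> as the new
  variable the resulting Levy density at \<open>x > 0\<close> is \<open>c / (T * b) * x powr (- 1 - \<alpha>)\<close> times the integral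
  of \<open>v powr (- 1 - \<alpha>) * exp (- \<beta> * v * x)\<close> over \<open>1 \<le> v \<le> 1 / a\<close>. Integrate by parts with the primitive
  \<open>G\<close> of \<open>v powr (- 1 - \<alpha>)\<close> that vanishes at \<open>1\<close> (\<open>time_integral_by_parts\<close>). The boundary term at
  \<open>v = 1 / a\<close> is a tempered stable density with parameters \<open>\<beta> / a\<close> and \<open>c * G (1 / a) / (T * b)\<close>:
  this is \<open>X1\<close>. In the remaining integral the factor \<open>x\<close> produced by differentiating the exponential
  lowers the singularity at \<open>0\<close> from \<open>x powr (- 1 - \<alpha>)\<close> to \<open>x powr - \<alpha>\<close>, so it has finite mass, and
  such a Levy density is that of a compound Poisson variable: this is \<open>X2\<close>
  (\<open>time_integral_of_exponent\<close>). Evaluating masses with the Gamma integral gives the Poisson parameter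
  and the normalisation of the jump density.

  The primitive \<open>G\<close> is \<open>(1 - v powr - \<alpha>) / \<alpha>\<close> for \<open>\<alpha> \<noteq> 0\<close> and \<open>ln v\<close> for \<open>\<alpha> = 0\<close>. The proof is carried
  out with \<open>G\<close>, uniformly in \<open>\<alpha>\<close>, and the parameters of the statement are identified with expressions
  in \<open>G\<close> that are continuous at \<open>\<alpha> = 0\<close>. The law of \<open>X1\<close> is realised as that of
  \<open>a * L s\<close> for a suitable time \<open>s\<close>.
\<close>

section \<open>Independence of random elements of different types\<close>

lemma (in prob_space) indep_rv_iff_prob:
  "indep_rv M A X B Y \<longleftrightarrow>
     X \<in> measurable M A \<and> Y \<in> measurable M B \<and>
     (\<forall>S\<in>sets A. \<forall>R\<in>sets B.
        prob ((X -` S \<inter> space M) \<inter> (Y -` R \<inter> space M)) =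
        prob (X -` S \<inter> space M) * prob (Y -` R \<inter> space M))"
proof (cases "X \<in> measurable M A \<and> Y \<in> measurable M B")
  case True
  then have X: "X \<in> measurable M A" and Y: "Y \<in> measurable M B" by auto
  have sX: "sets (vimage_algebra (space M) X A) = {X -` S \<inter> space M | S. S \<in> sets A}"
    using X by (intro sets_vimage_algebra2) (auto dest: measurable_space)
  have sY: "sets (vimage_algebra (space M) Y B) = {Y -` S \<inter> space M | S. S \<in> sets B}"
    using Y by (intro sets_vimage_algebra2) (auto dest: measurable_space)
  have "indep_set (sets (vimage_algebra (space M) X A)) (sets (vimage_algebra (space M) Y B)) \<longleftrightarrow>
     (\<forall>S\<in>sets A. \<forall>R\<in>sets B.
        prob ((X -` S \<inter> space M) \<inter> (Y -` R \<inter> space M)) =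
        prob (X -` S \<inter> space M) * prob (Y -` R \<inter> space M))"
    unfolding sX sY
  proof (intro iffI ballI)
    fix S R assume "indep_set {X -` S \<inter> space M |S. S \<in> sets A} {Y -` S \<inter> space M |S. S \<in> sets B}"
      "S \<in> sets A" "R \<in> sets B"
    then show "prob ((X -` S \<inter> space M) \<inter> (Y -` R \<inter> space M)) =
        prob (X -` S \<inter> space M) * prob (Y -` R \<inter> space M)"
      by (intro indep_setD) auto
  next
    assume *: "\<forall>S\<in>sets A. \<forall>R\<in>sets B.
        prob ((X -` S \<inter> space M) \<inter> (Y -` R \<inter> space M)) =
        prob (X -` S \<inter> space M) * prob (Y -` R \<inter> space M)"
    show "indep_set {X -` S \<inter> space M |S. S \<in> sets A} {Y -` S \<inter> space M |S. S \<in> sets B}"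
      using * X Y by (intro indep_setI) (auto simp: measurable_sets)
  qed
  with X Y show ?thesis by (simp add: indep_rv_def)
qed (auto simp: indep_rv_def)

text \<open>
  Measurable images of the two components may land in any types; the case of interest is that both
  land in the complex numbers, where expectations of products factorise.
\<close>

lemma (in prob_space) indep_rv_compose_indep_var:
  assumes ind: "indep_rv M A X B Y" and g: "g \<in> measurable A C" and h: "h \<in> measurable B D"
  shows "indep_var C (\<lambda>\<omega>. g (X \<omega>)) D (\<lambda>\<omega>. h (Y \<omega>))"
proof -
  from ind have X[measurable]: "X \<in> measurable M A" and Y[measurable]: "Y \<in> measurable M B"
    and *: "\<And>S R. S\<in>sets A \<Longrightarrow> R\<in>sets B \<Longrightarrow>
        prob ((X -` S \<inter> space M) \<inter> (Y -` R \<inter> space M)) =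
        prob (X -` S \<inter> space M) * prob (Y -` R \<inter> space M)"
    unfolding indep_rv_iff_prob by auto
  have gX: "(\<lambda>\<omega>. g (X \<omega>)) -` S \<inter> space M = X -` (g -` S \<inter> space A) \<inter> space M" for S
    using measurable_space[OF X] by auto
  have hY: "(\<lambda>\<omega>. h (Y \<omega>)) -` S \<inter> space M = Y -` (h -` S \<inter> space B) \<inter> space M" for S
    using measurable_space[OF Y] by auto
  show ?thesis
    unfolding indep_var_eq
  proof (intro conjI indep_set_sigma_sets)
    show "(\<lambda>\<omega>. g (X \<omega>)) \<in> measurable M C" "(\<lambda>\<omega>. h (Y \<omega>)) \<in> measurable M D"
      using g h by measurable
    show "indep_set {(\<lambda>\<omega>. g (X \<omega>)) -` A \<inter> space M |A. A \<in> sets C}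
      {(\<lambda>\<omega>. h (Y \<omega>)) -` A \<inter> space M |A. A \<in> sets D}"
    proof (rule indep_setI)
      show "{(\<lambda>\<omega>. g (X \<omega>)) -` A \<inter> space M |A. A \<in> sets C} \<subseteq> events"
        using g unfolding gX by (auto intro!: measurable_sets[OF X] measurable_sets)
      show "{(\<lambda>\<omega>. h (Y \<omega>)) -` A \<inter> space M |A. A \<in> sets D} \<subseteq> events"
        using h unfolding hY by (auto intro!: measurable_sets[OF Y] measurable_sets)
      show "prob (a \<inter> b) = prob a * prob b"
        if "a \<in> {(\<lambda>\<omega>. g (X \<omega>)) -` A \<inter> space M |A. A \<in> sets C}"
           "b \<in> {(\<lambda>\<omega>. h (Y \<omega>)) -` A \<inter> space M |A. A \<in> sets D}" for a b
      proof -
        from that obtain S R where "a = (\<lambda>\<omega>. g (X \<omega>)) -` S \<inter> space M" "S \<in> sets C"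
          "b = (\<lambda>\<omega>. h (Y \<omega>)) -` R \<inter> space M" "R \<in> sets D" by auto
        then show ?thesis
          unfolding gX hY using *[OF measurable_sets[OF g] measurable_sets[OF h]] by simp
      qed
    qed
    show "Int_stable {(\<lambda>\<omega>. g (X \<omega>)) -` A \<inter> space M |A. A \<in> sets C}"
      unfolding Int_stable_def
    proof safe
      fix S R assume "S \<in> sets C" "R \<in> sets C"
      then show "\<exists>A. (\<lambda>\<omega>. g (X \<omega>)) -` S \<inter> space M \<inter> ((\<lambda>\<omega>. g (X \<omega>)) -` R \<inter> space M) = 
         (\<lambda>\<omega>. g (X \<omega>)) -` A \<inter> space M \<and> A \<in> sets C"
        by (intro exI[of _ "S \<inter> R"]) auto
    qed
    show "Int_stable {(\<lambda>\<omega>. h (Y \<omega>)) -` A \<inter> space M |A. A \<in> sets D}"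
      unfolding Int_stable_def
    proof safe
      fix S R assume "S \<in> sets D" "R \<in> sets D"
      then show "\<exists>A. (\<lambda>\<omega>. h (Y \<omega>)) -` S \<inter> space M \<inter> ((\<lambda>\<omega>. h (Y \<omega>)) -` R \<inter> space M) = 
         (\<lambda>\<omega>. h (Y \<omega>)) -` A \<inter> space M \<and> A \<in> sets D"
        by (intro exI[of _ "S \<inter> R"]) auto
    qed
  qed
qed

text \<open>
  The restrictions of a family of independent variables to two disjoint index sets have one and the
  same type; applying different measurable maps to them yields independent elements of different types.
\<close>

lemma (in prob_space) indep_var_compose_indep_rv:
  assumes ind: "indep_var C U D V" and g: "g \<in> measurable C A" and h: "h \<in> measurable D B"
  shows "indep_rv M A (\<lambda>\<omega>. g (U \<omega>)) B (\<lambda>\<omega>. h (V \<omega>))"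
proof -
  note [measurable] = indep_var_rv1[OF ind] indep_var_rv2[OF ind] g h
  have gX: "(\<lambda>\<omega>. g (U \<omega>)) -` S \<inter> space M = U -` (g -` S \<inter> space C) \<inter> space M" for S
    using measurable_space[OF indep_var_rv1[OF ind]] by auto
  have hY: "(\<lambda>\<omega>. h (V \<omega>)) -` S \<inter> space M = V -` (h -` S \<inter> space D) \<inter> space M" for S
    using measurable_space[OF indep_var_rv2[OF ind]] by auto
  have "prob ((U -` (g -` S \<inter> space C) \<inter> space M) \<inter> (V -` (h -` R \<inter> space D) \<inter> space M)) =
     prob (U -` (g -` S \<inter> space C) \<inter> space M) * prob (V -` (h -` R \<inter> space D) \<inter> space M)"
    if "S \<in> sets A" "R \<in> sets B" for S R
  proof -
    have "prob ((\<lambda>x. (U x, V x)) -` ((g -` S \<inter> space C) \<times> (h -` R \<inter> space D)) \<inter> space M) =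
       prob (U -` (g -` S \<inter> space C) \<inter> space M) * prob (V -` (h -` R \<inter> space D) \<inter> space M)"
      using that by (intro indep_varD[OF ind]) auto
    also have "(\<lambda>x. (U x, V x)) -` ((g -` S \<inter> space C) \<times> (h -` R \<inter> space D)) \<inter> space M =
      (U -` (g -` S \<inter> space C) \<inter> space M) \<inter> (V -` (h -` R \<inter> space D) \<inter> space M)" by auto
    finally show ?thesis .
  qed
  then show ?thesis
    unfolding indep_rv_iff_prob gX hY by auto
qed

lemma (in prob_space) integral_indep_rv_mult:
  fixes g h :: "_ \<Rightarrow> complex"
  assumes "indep_rv M A X B Y" "g \<in> borel_measurable A" "h \<in> borel_measurable B"
    and "integrable M (\<lambda>\<omega>. g (X \<omega>))" "integrable M (\<lambda>\<omega>. h (Y \<omega>))"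
  shows "(\<integral>\<omega>. g (X \<omega>) * h (Y \<omega>) \<partial>M) = (\<integral>\<omega>. g (X \<omega>) \<partial>M) * (\<integral>\<omega>. h (Y \<omega>) \<partial>M)"
  by (intro indep_var_lebesgue_integral indep_rv_compose_indep_var[OF assms(1)] assms(2-5))

section \<open>Compound Poisson laws\<close>

text \<open>
  The product measure on sequences provides countably many independent coordinates: coordinates 0 and
  1 carry the two given laws, coordinate 2 the Poisson count, the later ones the jumps.
\<close>

lemma compound_poisson_exists:
  fixes \<mu>0 \<mu>1 :: "real measure" and f :: "real \<Rightarrow> real"
  assumes "real_distribution \<mu>0" "real_distribution \<mu>1" and \<Lambda>: "\<Lambda> > 0"
    and f[measurable]: "f \<in> borel_measurable borel"
    and f1: "prob_space (density lborel (\<lambda>x. ennreal (f x)))"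
  shows "\<exists>(P :: (nat \<Rightarrow> real) measure) X0 X1 X2 N J. prob_space P
     \<and> prob_space.indep_vars P (\<lambda>_. borel) (\<lambda>i. [X0, X1, X2] ! i) {..<3}
     \<and> distr P borel X0 = \<mu>0 \<and> distr P borel X1 = \<mu>1
     \<and> compound_poisson P \<Lambda> f N J X2"
proof -
  interpret \<mu>0: real_distribution \<mu>0 by fact
  interpret \<mu>1: real_distribution \<mu>1 by fact
  define \<nu> where "\<nu> = distr (measure_pmf (poisson_pmf \<Lambda>)) borel real"
  define D where "D = density lborel (\<lambda>x. ennreal (f x))"
  define \<mu> where "\<mu> = (\<lambda>i::nat. if i = 0 then \<mu>0 else if i = 1 then \<mu>1 else if i = 2 then \<nu> else D)"
  have \<mu>_sets[measurable_cong, simp]: "sets (\<mu> i) = sets borel" for i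
    by (simp add: \<mu>_def \<nu>_def D_def)
  have \<mu>_prob: "prob_space (\<mu> i)" for i
    using f1 by (auto simp: \<mu>_def \<nu>_def D_def \<mu>0.prob_space_axioms \<mu>1.prob_space_axioms
        intro!: measure_pmf.prob_space_distr)
  define P where "P = PiM UNIV \<mu>"
  interpret prod: product_prob_space \<mu> UNIV
    by (intro product_prob_spaceI \<mu>_prob)
  interpret P: prob_space P unfolding P_def by (rule prod.prob_space_axioms)
  have P_sets: "sets P = sets (PiM UNIV (\<lambda>_. borel))"
    unfolding P_def by (intro sets_PiM_cong) auto
  have [measurable]: "(\<lambda>\<omega>. \<omega> i) \<in> borel_measurable P" for i
    by (subst measurable_cong_sets[OF P_sets refl]) measurable
  have comp: "distr P borel (\<lambda>\<omega>. \<omega> i) = \<mu> i" for i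
  proof -
    have "distr P borel (\<lambda>\<omega>. \<omega> i) = distr P (\<mu> i) (\<lambda>\<omega>. \<omega> i)"
      by (intro distr_cong) auto
    also have "\<dots> = \<mu> i" unfolding P_def by (rule prod.PiM_component) simp
    finally show ?thesis .
  qed
  have ind: "P.indep_vars (\<lambda>_. borel) (\<lambda>i \<omega>. \<omega> i) UNIV"
  proof (subst P.indep_vars_iff_distr_eq_PiM)
    have sp: "space P = UNIV" using sets_eq_imp_space_eq[OF P_sets] by (simp add: space_PiM)
    have "distr P (PiM UNIV (\<lambda>_. borel)) (\<lambda>x. \<lambda>i\<in>UNIV. x i) = distr P P (\<lambda>x. x)"
      by (intro distr_cong) (auto simp: P_sets)
    then show "distr P (PiM UNIV (\<lambda>_. borel)) (\<lambda>x. \<lambda>i\<in>UNIV. x i) = PiM UNIV (\<lambda>i. distr P borel (\<lambda>\<omega>. \<omega> i))"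
      unfolding comp by (simp add: P_def)
  qed auto
  define N where "N = (\<lambda>\<omega>::nat \<Rightarrow> real. nat \<lfloor>\<omega> 2\<rfloor>)"
  define J where "J = (\<lambda>k (\<omega>::nat \<Rightarrow> real). \<omega> (k + 2))"
  define X2 where "X2 = (\<lambda>\<omega>. \<Sum>k=1..N \<omega>. J k \<omega>)"
  have N_meas: "N \<in> measurable P (count_space UNIV)" unfolding N_def by measurable
  have N_distr: "distr P (count_space UNIV) N = measure_pmf (poisson_pmf \<Lambda>)"
  proof -
    have "distr P (count_space UNIV) N = distr (distr P borel (\<lambda>\<omega>. \<omega> 2)) (count_space UNIV) (\<lambda>x. nat \<lfloor>x\<rfloor>)"
      by (subst distr_distr) (auto simp: N_def comp_def)
    also have "\<dots> = distr (measure_pmf (poisson_pmf \<Lambda>)) (count_space UNIV) (\<lambda>x. x)"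
      unfolding comp \<mu>_def \<nu>_def by (simp, subst distr_distr) (auto simp: comp_def)
    also have "\<dots> = measure_pmf (poisson_pmf \<Lambda>)" by (rule distr_id2) simp
    finally show ?thesis .
  qed
  have NJ: "indep_rv P (count_space UNIV) N (PiM {1..} (\<lambda>_. borel)) (\<lambda>\<omega>. \<lambda>k\<in>{1..}. J k \<omega>)"
  proof -
    have "P.indep_var (PiM {2} (\<lambda>_. borel)) (\<lambda>\<omega>. restrict \<omega> {2}) (PiM {3..} (\<lambda>_. borel)) (\<lambda>\<omega>. restrict \<omega> {3..})"
      by (rule P.indep_var_restrict[OF ind]) auto
    then have "indep_rv P (count_space UNIV) (\<lambda>\<omega>. nat \<lfloor>restrict \<omega> {2} 2\<rfloor>)
        (PiM {1..} (\<lambda>_. borel)) (\<lambda>\<omega>. \<lambda>k\<in>{1..}. restrict \<omega> {3..} (k + 2))"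
    proof (rule P.indep_var_compose_indep_rv)
      show "(\<lambda>\<omega>. \<lambda>k\<in>{1..}. \<omega> (k + 2)) \<in> PiM {3..} (\<lambda>_. borel) \<rightarrow>\<^sub>M PiM {1::nat..} (\<lambda>_. borel :: real measure)"
        by (intro measurable_restrict measurable_component_singleton) auto
      show "(\<lambda>\<omega>. nat \<lfloor>\<omega> 2\<rfloor>) \<in> measurable (PiM {2::nat} (\<lambda>_. borel :: real measure)) (count_space UNIV)"
        by measurable
    qed
    moreover have "(\<lambda>\<omega>. \<lambda>k\<in>{1..}. restrict \<omega> {3..} (k + 2)) = (\<lambda>\<omega>. \<lambda>k\<in>{1..}. J k \<omega>)"
      by (auto simp: J_def fun_eq_iff restrict_def)
    ultimately show ?thesis by (simp add: N_def)
  qed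
  have J_ind: "P.indep_vars (\<lambda>_. borel) J {1..}"
  proof -
    have "P.indep_vars (\<lambda>j. PiM {j + 2} (\<lambda>_. borel)) (\<lambda>j \<omega>. restrict \<omega> {j + 2}) {1..}"
      by (rule P.indep_vars_restrict[OF ind]) (auto simp: disjoint_family_on_def)
    then have "P.indep_vars (\<lambda>_. borel) (\<lambda>j \<omega>. restrict \<omega> {j + 2} (j + 2)) {1..}"
      by (rule P.indep_vars_compose2) measurable
    then show ?thesis by (simp add: J_def)
  qed
  have J_distr: "distributed P lborel (J k) (\<lambda>x. ennreal (f x))" if "k \<ge> 1" for k
  proof -
    have "distr P lborel (J k) = distr P borel (J k)" by (intro distr_cong) auto
    then show ?thesis
      using that by (auto simp: distributed_def J_def comp) (simp add: \<mu>_def D_def)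
  qed
  have cp: "compound_poisson P \<Lambda> f N J X2"
    unfolding compound_poisson_def using \<Lambda> N_meas N_distr J_ind J_distr NJ by (simp add: X2_def)
  have ind3: "P.indep_vars (\<lambda>_. borel) (\<lambda>i. [\<lambda>\<omega>. \<omega> 0, \<lambda>\<omega>. \<omega> 1, X2] ! i) {..<3}"
  proof -
    define K where "K = (\<lambda>i::nat. if i = 0 then {0} else if i = 1 then {1} else {2::nat..})"
    define h :: "nat \<Rightarrow> (nat \<Rightarrow> real) \<Rightarrow> real" where
      "h = (\<lambda>i \<omega>. if i = 0 then \<omega> 0 else if i = 1 then \<omega> 1 else \<Sum>k=1..nat \<lfloor>\<omega> 2\<rfloor>. \<omega> (k + 2))"
    have "P.indep_vars (\<lambda>j. PiM (K j) (\<lambda>_. borel)) (\<lambda>j \<omega>. restrict \<omega> (K j)) {..<3}"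
      by (rule P.indep_vars_restrict[OF ind]) (auto simp: disjoint_family_on_def K_def)
    then have "P.indep_vars (\<lambda>_. borel) (\<lambda>j \<omega>. h j (restrict \<omega> (K j))) {..<3}"
    proof (rule P.indep_vars_compose2)
      fix i :: nat
      have m: "(\<lambda>\<omega>. \<omega> j) \<in> borel_measurable (PiM {2..} (\<lambda>_. borel))" if "j \<ge> 2" for j :: nat
        using that by (intro measurable_component_singleton) auto
      have "(\<lambda>\<omega>. \<Sum>k=1..nat \<lfloor>\<omega> 2\<rfloor>. \<omega> (k + 2)) \<in> borel_measurable (PiM {2::nat..} (\<lambda>_. borel :: real measure))"
      proof (rule measurable_compose_countable)
        show "(\<lambda>\<omega>. nat \<lfloor>\<omega> 2\<rfloor>) \<in> measurable (PiM {2::nat..} (\<lambda>_. borel :: real measure)) (count_space UNIV)"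
          using m[of 2] by measurable
        show "(\<lambda>\<omega>. \<Sum>k=1..n. \<omega> (k + 2)) \<in> borel_measurable (PiM {2::nat..} (\<lambda>_. borel :: real measure))" for n :: nat
          by (intro borel_measurable_sum m) simp
      qed
      then show "h i \<in> borel_measurable (PiM (K i) (\<lambda>_. borel))"
        by (auto simp: h_def K_def)
    qed
    then show ?thesis
      by (rule P.indep_vars_cong[THEN iffD1, rotated -1])
         (auto simp: h_def K_def X2_def N_def J_def fun_eq_iff less_Suc_eq numeral_3_eq_3)
  qed
  show ?thesis
    by (rule exI[of _ P], rule exI[of _ "\<lambda>\<omega>. \<omega> 0"], rule exI[of _ "\<lambda>\<omega>. \<omega> 1"], rule exI[of _ X2],
        rule exI[of _ N], rule exI[of _ J])
       (use P.prob_space_axioms ind3 cp in \<open>auto simp: comp \<mu>_def\<close>)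
qed

text \<open>
  Conditioning on the number of jumps gives the power series
  \<open>\<Sum>n. exp (- \<Lambda>) * \<Lambda> ^ n / fact n * \<phi> ^ n\<close>, where \<open>\<phi>\<close> is the characteristic function of a jump.
\<close>

lemma char_compound_poisson:
  assumes "prob_space P" and cp: "compound_poisson P \<Lambda> f N J Y"
  shows "char (distr P borel Y) u =
     exp (complex_of_real \<Lambda> * (char (density lborel (\<lambda>x. ennreal (f x))) u - 1))"
    and "Y \<in> borel_measurable P"
proof -
  interpret prob_space P by fact
  from cp have \<Lambda>: "\<Lambda> > 0" and N[measurable]: "N \<in> measurable P (count_space UNIV)"
    and Nd: "distr P (count_space UNIV) N = measure_pmf (poisson_pmf \<Lambda>)"
    and Ji: "indep_vars (\<lambda>_. borel) J {1..}"
    and Jd: "\<And>k. k \<ge> 1 \<Longrightarrow> distributed P lborel (J k) (\<lambda>x. ennreal (f x))"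
    and NJ: "indep_rv P (count_space UNIV) N (Pi\<^sub>M {1..} (\<lambda>_. borel)) (\<lambda>\<omega>. \<lambda>k\<in>{1..}. J k \<omega>)"
    and Y: "\<And>\<omega>. \<omega> \<in> space P \<Longrightarrow> Y \<omega> = (\<Sum>k=1..N \<omega>. J k \<omega>)"
    unfolding compound_poisson_def by auto
  define \<phi> where "\<phi> = char (density lborel (\<lambda>x. ennreal (f x))) u"
  define S where "S = (\<lambda>n \<omega>. \<Sum>k=1..n. J k \<omega>)"
  have J[measurable]: "J k \<in> borel_measurable P" if "k \<ge> 1" for k
    using Ji that by (auto simp: indep_vars_def)
  have S[measurable]: "S n \<in> borel_measurable P" for n
    unfolding S_def by (intro borel_measurable_sum J) auto
  have "(\<lambda>\<omega>. S (N \<omega>) \<omega>) \<in> borel_measurable P"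
    by (rule measurable_compose_countable[OF S N])
  then show Ym[measurable]: "Y \<in> borel_measurable P"
    by (rule measurable_cong[THEN iffD1, rotated]) (simp add: S_def Y)
  have charS: "char (distr P borel (S n)) u = \<phi> ^ n" for n
  proof -
    have "indep_vars (\<lambda>_. borel) J {1..n}" by (rule indep_vars_subset[OF Ji]) auto
    then have "char (distr P borel (S n)) u = (\<Prod>k=1..n. char (distr P borel (J k)) u)"
      unfolding S_def by (rule char_distr_sum)
    also have "\<dots> = (\<Prod>k=1..n. \<phi>)"
    proof (rule prod.cong)
      fix k assume "k \<in> {1..n}"
      then have "distr P lborel (J k) = density lborel (\<lambda>x. ennreal (f x))"
        using Jd[of k] by (simp add: distributed_def)
      moreover have "distr P lborel (J k) = distr P borel (J k)" by (intro distr_cong) auto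
      ultimately show "char (distr P borel (J k)) u = \<phi>" by (simp add: \<phi>_def)
    qed simp
    finally show ?thesis by simp
  qed
  have probN: "prob {\<omega>\<in>space P. N \<omega> = n} = \<Lambda> ^ n / fact n * exp (- \<Lambda>)" for n
  proof -
    have "prob {\<omega>\<in>space P. N \<omega> = n} = measure (distr P (count_space UNIV) N) {n}"
      by (subst measure_distr) (auto intro!: arg_cong[where f=prob])
    also have "\<dots> = pmf (poisson_pmf \<Lambda>) n" unfolding Nd by (simp add: pmf.rep_eq)
    finally show ?thesis using \<Lambda> by simp
  qed
  have S_restrict: "(\<Sum>k = 1..n. (\<lambda>k\<in>{1..}. J k \<omega>) k) = S n \<omega>" for n \<omega>
    unfolding S_def by (intro sum.cong) auto
  \<comment> \<open>The function \<open>iexp (u * Y)\<close> restricted to the event of exactly \<open>n\<close> jumps.\<close>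
  define F where "F = (\<lambda>n \<omega>. complex_of_real (indicator {n} (N \<omega>)) * iexp (u * S n \<omega>))"
  have Fm[measurable]: "F n \<in> borel_measurable P" for n
  proof -
    have [measurable]: "(\<lambda>\<omega>. complex_of_real (indicator {n} (N \<omega>))) \<in> borel_measurable P"
      by (rule measurable_compose[OF N]) simp
    show ?thesis unfolding F_def by measurable
  qed
  have normF: "norm (F n \<omega>) = indicator {\<omega>\<in>space P. N \<omega> = n} \<omega>" if "\<omega> \<in> space P" for n \<omega>
    using that by (auto simp: F_def norm_mult indicator_def)
  have Fi: "integrable P (F n)" for n
    by (rule integrable_const_bound[where B=1]) (auto simp: normF indicator_def)
  have intF: "(\<integral>\<omega>. F n \<omega> \<partial>P) = complex_of_real (\<Lambda> ^ n / fact n * exp (- \<Lambda>)) * \<phi> ^ n" for n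
  proof -
    have "(\<integral>\<omega>. F n \<omega> \<partial>P) = (\<integral>\<omega>. complex_of_real (indicator {n} (N \<omega>)) * 
            iexp (u * (\<Sum>k=1..n. (\<lambda>k\<in>{1..}. J k \<omega>) k)) \<partial>P)"
      by (intro Bochner_Integration.integral_cong) (auto simp: F_def S_def)
    also have "\<dots> = (\<integral>\<omega>. complex_of_real (indicator {n} (N \<omega>)) \<partial>P) * 
            (\<integral>\<omega>. iexp (u * (\<Sum>k=1..n. (\<lambda>k\<in>{1..}. J k \<omega>) k)) \<partial>P)"
    proof (rule integral_indep_rv_mult[OF NJ])
      show "(\<lambda>x. iexp (u * (\<Sum>k = 1..n. x k))) \<in> borel_measurable (Pi\<^sub>M {1..} (\<lambda>_. borel))"
        by measurable
      have "integrable P (\<lambda>\<omega>. iexp (u * S n \<omega>))" by (intro integrable_iexp) auto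
      then show "integrable P (\<lambda>\<omega>. iexp (u * (\<Sum>k = 1..n. (\<lambda>k\<in>{1..}. J k \<omega>) k)))"
        by (simp only: S_restrict)
      show "integrable P (\<lambda>\<omega>. complex_of_real (indicator {n} (N \<omega>)))"
        by (rule integrable_const_bound[where B=1])
           (auto simp: indicator_def intro!: measurable_compose[OF N])
    qed simp
    also have "(\<integral>\<omega>. complex_of_real (indicator {n} (N \<omega>)) \<partial>P) = complex_of_real (\<integral>\<omega>. indicator {\<omega>\<in>space P. N \<omega> = n} \<omega> \<partial>P)"
      by (subst integral_complex_of_real[symmetric]) (auto intro!: Bochner_Integration.integral_cong simp: indicator_def)
    also have "(\<integral>\<omega>. indicator {\<omega>\<in>space P. N \<omega> = n} \<omega> \<partial>P) = \<Lambda> ^ n / fact n * exp (- \<Lambda>)"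
      by (simp add: probN)
    also have "(\<integral>\<omega>. iexp (u * (\<Sum>k=1..n. (\<lambda>k\<in>{1..}. J k \<omega>) k)) \<partial>P) = char (distr P borel (S n)) u"
      by (simp only: S_restrict) (simp add: char_def integral_distr)
    finally show ?thesis unfolding charS .
  qed
  have sumF: "(\<lambda>n. F n \<omega>) sums iexp (u * Y \<omega>)" if "\<omega> \<in> space P" for \<omega>
  proof -
    have "(\<lambda>n. F n \<omega>) sums (\<Sum>n\<in>{N \<omega>}. F n \<omega>)"
      by (rule sums_finite) (auto simp: F_def)
    then show ?thesis using Y[OF that] by (simp add: F_def S_def)
  qed
  have "char (distr P borel Y) u = (\<integral>\<omega>. iexp (u * Y \<omega>) \<partial>P)"
    by (simp add: char_def integral_distr)
  also have "\<dots> = (\<integral>\<omega>. (\<Sum>n. F n \<omega>) \<partial>P)"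
    by (intro Bochner_Integration.integral_cong refl sums_unique sumF)
  finally have eq: "char (distr P borel Y) u = (\<integral>\<omega>. (\<Sum>n. F n \<omega>) \<partial>P)" .
  have "(\<lambda>n. \<integral>\<omega>. F n \<omega> \<partial>P) sums (\<integral>\<omega>. (\<Sum>n. F n \<omega>) \<partial>P)"
  proof (rule sums_integral)
    show "AE \<omega> in P. summable (\<lambda>n. norm (F n \<omega>))"
    proof (rule AE_I2)
      fix \<omega> assume "\<omega> \<in> space P"
      show "summable (\<lambda>n. norm (F n \<omega>))"
        by (rule summable_finite[of "{N \<omega>}"]) (auto simp: F_def)
    qed
    have "(\<integral>\<omega>. norm (F n \<omega>) \<partial>P) = \<Lambda> ^ n / fact n * exp (- \<Lambda>)" for n
      by (subst Bochner_Integration.integral_cong[OF refl normF]) (auto simp: probN)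
    moreover have "summable (\<lambda>n. \<Lambda> ^ n / fact n * exp (- \<Lambda>))"
      using summable_exp[of \<Lambda>] by (intro summable_mult2) (simp add: field_simps)
    ultimately show "summable (\<lambda>n. \<integral>\<omega>. norm (F n \<omega>) \<partial>P)" by simp
  qed (rule Fi)
  moreover have "(\<lambda>n. \<integral>\<omega>. F n \<omega> \<partial>P) sums (exp (complex_of_real \<Lambda> * \<phi>) * exp (- complex_of_real \<Lambda>))"
  proof -
    have "(\<lambda>n. ((complex_of_real \<Lambda> * \<phi>) ^ n /\<^sub>R fact n) * exp (- complex_of_real \<Lambda>)) sums
       (exp (complex_of_real \<Lambda> * \<phi>) * exp (- complex_of_real \<Lambda>))"
      by (intro sums_mult2 exp_converges)
    then show ?thesis
      by (simp add: intF scaleR_conv_of_real exp_of_real[symmetric] power_mult_distrib field_simps)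
  qed
  ultimately have "char (distr P borel Y) u = exp (complex_of_real \<Lambda> * \<phi>) * exp (- complex_of_real \<Lambda>)"
    unfolding eq by (rule sums_unique2)
  then show "char (distr P borel Y) u =
     exp (complex_of_real \<Lambda> * (char (density lborel (\<lambda>x. ennreal (f x))) u - 1))"
    by (simp add: exp_add[symmetric] algebra_simps \<phi>_def)
qed

lemma compound_poisson_nonneg:
  assumes "prob_space P" and cp: "compound_poisson P \<Lambda> f N J Y" and f: "\<And>x. x < 0 \<Longrightarrow> f x = 0"
    and [measurable]: "f \<in> borel_measurable borel"
  shows "AE \<omega> in P. 0 \<le> Y \<omega>"
proof -
  from cp have Jd: "\<And>k. k \<ge> 1 \<Longrightarrow> distributed P lborel (J k) (\<lambda>x. ennreal (f x))"
    and Y: "\<And>\<omega>. \<omega> \<in> space P \<Longrightarrow> Y \<omega> = (\<Sum>k=1..N \<omega>. J k \<omega>)"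
    unfolding compound_poisson_def by auto
  have "AE \<omega> in P. 0 \<le> J k \<omega>" if "k \<ge> 1" for k
  proof (rule AE_distrD[where M'=lborel])
    show "J k \<in> measurable P lborel" using Jd[OF that] by (simp add: distributed_def)
    have d: "distr P lborel (J k) = density lborel (\<lambda>x. ennreal (f x))"
      using Jd[OF that] by (simp add: distributed_def)
    show "AE x in distr P lborel (J k). 0 \<le> x"
      unfolding d
    proof -
      have "0 < ennreal (f x) \<longrightarrow> 0 \<le> x" for x
        using f[of x] by (cases "x < 0") auto
      then show "AE x in density lborel (\<lambda>x. ennreal (f x)). 0 \<le> x"
        by (subst AE_density) auto
    qed
  qed
  then have "AE \<omega> in P. \<forall>k\<in>{1..}. 0 \<le> J k \<omega>"
    by (subst AE_ball_countable) auto
  with AE_space show ?thesis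
    by eventually_elim (auto simp: Y intro!: sum_nonneg)
qed

section \<open>Levy exponents without drift and Gaussian part\<close>

lemma norm_iexp_diff_le: "norm (iexp x - iexp y) \<le> \<bar>x - y\<bar>"
proof -
  have "norm (iexp (x - y) - 1) \<le> \<bar>x - y\<bar>"
    using iexp_approx1[of "x - y" 0] by simp
  moreover have "iexp x - iexp y = iexp y * (iexp (x - y) - 1)"
    by (simp add: algebra_simps exp_add[symmetric])
  ultimately show ?thesis by (simp add: norm_mult)
qed

text \<open>
  Integration is not compensated, so the Levy density must have a finite integral near \<open>0\<close> after
  multiplication by \<open>\<bar>x\<bar>\<close>; this holds for subordinators such as the tempered stable ones with \<open>\<alpha> < 1\<close>.
\<close>

definition levy_exponent :: "(real \<Rightarrow> real) \<Rightarrow> real \<Rightarrow> complex" where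
  "levy_exponent \<nu> u = (CLINT x|lborel. (iexp (u * x) - 1) * complex_of_real (\<nu> x))"

lemma levy_exponent_0 [simp]: "levy_exponent \<nu> 0 = 0"
  by (simp add: levy_exponent_def)

lemma levy_exponent_scale: "levy_exponent (\<lambda>x. k * \<nu> x) u = complex_of_real k * levy_exponent \<nu> u"
proof -
  have "levy_exponent (\<lambda>x. k * \<nu> x) u =
    (CLINT x|lborel. complex_of_real k * ((iexp (u * x) - 1) * complex_of_real (\<nu> x)))"
    unfolding levy_exponent_def by (intro Bochner_Integration.integral_cong) (auto simp: field_simps)
  then show ?thesis unfolding levy_exponent_def by simp
qed

lemma levy_exponent_integrable:
  assumes [measurable]: "\<nu> \<in> borel_measurable borel"
    and int: "integrable lborel (\<lambda>x. \<bar>x\<bar> * \<bar>\<nu> x\<bar>)"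
  shows "integrable lborel (\<lambda>x. (iexp (u * x) - 1) * complex_of_real (\<nu> x))"
proof (rule Bochner_Integration.integrable_bound)
  show "integrable lborel (\<lambda>x. \<bar>u\<bar> * (\<bar>x\<bar> * \<bar>\<nu> x\<bar>))" using int by simp
  show "AE x in lborel. norm ((iexp (u * x) - 1) * complex_of_real (\<nu> x)) \<le> norm (\<bar>u\<bar> * (\<bar>x\<bar> * \<bar>\<nu> x\<bar>))"
  proof (rule AE_I2)
    fix x :: real
    have "norm (iexp (u * x) - 1) \<le> \<bar>u * x\<bar>" using norm_iexp_diff_le[of "u * x" 0] by simp
    then have "norm (iexp (u * x) - 1) * \<bar>\<nu> x\<bar> \<le> \<bar>u * x\<bar> * \<bar>\<nu> x\<bar>" by (intro mult_right_mono) auto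
    then show "norm ((iexp (u * x) - 1) * complex_of_real (\<nu> x)) \<le> norm (\<bar>u\<bar> * (\<bar>x\<bar> * \<bar>\<nu> x\<bar>))"
      by (simp add: norm_mult abs_mult mult.assoc)
  qed
qed simp

text \<open>
  The exponent is Lipschitz: \<open>iexp\<close> is, and the Lipschitz constant of \<open>u \<mapsto> iexp (u * x)\<close> is \<open>\<bar>x\<bar>\<close>,
  which is integrable against the Levy density.
\<close>

lemma levy_exponent_continuous:
  assumes [measurable]: "\<nu> \<in> borel_measurable borel"
    and int: "integrable lborel (\<lambda>x. \<bar>x\<bar> * \<bar>\<nu> x\<bar>)"
  shows "continuous_on S (levy_exponent \<nu>)"
proof -
  define C where "C = (LINT x|lborel. \<bar>x\<bar> * \<bar>\<nu> x\<bar>)"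
  have C: "C \<ge> 0" unfolding C_def by (intro integral_nonneg_AE) auto
  have lip: "dist (levy_exponent \<nu> u) (levy_exponent \<nu> w) \<le> C * dist u w" for u w
  proof -
    have "levy_exponent \<nu> u - levy_exponent \<nu> w =
       (CLINT x|lborel. (iexp (u * x) - iexp (w * x)) * complex_of_real (\<nu> x))"
      unfolding levy_exponent_def
      by (subst Bochner_Integration.integral_diff[symmetric])
         (intro levy_exponent_integrable int assms Bochner_Integration.integral_cong refl | simp add: algebra_simps)+
    also have "norm \<dots> \<le> (LINT x|lborel. \<bar>u - w\<bar> * (\<bar>x\<bar> * \<bar>\<nu> x\<bar>))"
    proof (rule Bochner_Integration.integral_norm_bound_integral)
      have "integrable lborel (\<lambda>x. (iexp (u * x) - 1) * complex_of_real (\<nu> x) - (iexp (w * x) - 1) * complex_of_real (\<nu> x))"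
        by (intro Bochner_Integration.integrable_diff levy_exponent_integrable int) auto
      then show "integrable lborel (\<lambda>x. (iexp (u * x) - iexp (w * x)) * complex_of_real (\<nu> x))"
        by (simp add: algebra_simps)
      show "norm ((iexp (u * x) - iexp (w * x)) * complex_of_real (\<nu> x)) \<le> \<bar>u - w\<bar> * (\<bar>x\<bar> * \<bar>\<nu> x\<bar>)" for x
      proof -
        have "norm (iexp (u * x) - iexp (w * x)) * \<bar>\<nu> x\<bar> \<le> \<bar>u * x - w * x\<bar> * \<bar>\<nu> x\<bar>"
          by (intro mult_right_mono norm_iexp_diff_le) auto
        then show ?thesis by (simp add: norm_mult abs_mult left_diff_distrib[symmetric] mult.assoc)
      qed
    qed (use int in auto)
    also have "\<dots> = C * dist u w" by (simp add: C_def dist_real_def)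
    finally show ?thesis by (simp add: dist_norm)
  qed
  have "C-lipschitz_on S (levy_exponent \<nu>)"
    by (rule lipschitz_onI) (use lip C in auto)
  then show ?thesis by (rule lipschitz_on_continuous_on)
qed

text \<open>
  With \<open>levy_exponent_scale\<close> this identifies the exponent of a finite Levy density with that of the
  compound Poisson law having the same jumps.
\<close>

lemma levy_exponent_prob_density:
  assumes [measurable]: "f \<in> borel_measurable borel" and nn: "\<And>x. f x \<ge> 0"
    and p: "prob_space (density lborel (\<lambda>x. ennreal (f x)))"
  shows "levy_exponent f u = char (density lborel (\<lambda>x. ennreal (f x))) u - 1"
proof -
  have "(\<integral>\<^sup>+x. ennreal (f x) \<partial>lborel) = 1"
    using prob_space.emeasure_space_1[OF p] by (simp add: emeasure_density)
  then have f1: "integrable lborel f" "(\<integral>x. f x \<partial>lborel) = 1"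
    using nn by (auto intro!: integrableI_nonneg simp: integral_eq_nn_integral)
  have i: "integrable lborel (\<lambda>x. f x *\<^sub>R iexp (u * x))"
    by (rule Bochner_Integration.integrable_bound[OF f1(1)]) (auto simp: nn)
  have "levy_exponent f u = (\<integral>x. f x *\<^sub>R iexp (u * x) - complex_of_real (f x) \<partial>lborel)"
    unfolding levy_exponent_def
    by (intro Bochner_Integration.integral_cong) (auto simp: scaleR_conv_of_real algebra_simps)
  also have "\<dots> = (\<integral>x. f x *\<^sub>R iexp (u * x) \<partial>lborel) - (\<integral>x. complex_of_real (f x) \<partial>lborel)"
    using f1(1) by (intro Bochner_Integration.integral_diff i) auto
  also have "(\<integral>x. f x *\<^sub>R iexp (u * x) \<partial>lborel) = char (density lborel (\<lambda>x. ennreal (f x))) u"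
    unfolding char_def by (subst integral_density) (auto simp: nn)
  finally show ?thesis by (simp add: f1)
qed

section \<open>Classical tempered stable laws live on the half line\<close>

text \<open>
  The Gamma integral after the substitution of \<open>\<theta> * x\<close> for \<open>x\<close>.
\<close>

lemma nn_integral_powr_exp:
  assumes "\<alpha> < 1" "\<theta> > 0"
  shows "(\<integral>\<^sup>+x. ennreal (indicator {0<..} x * (x powr - \<alpha> * exp (- \<theta> * x))) \<partial>lborel) =
    ennreal (Gamma (1 - \<alpha>) * \<theta> powr (\<alpha> - 1))"
proof -
  define I where "I = (\<integral>\<^sup>+x. ennreal (indicator {0<..} x * (x powr - \<alpha> * exp (- \<theta> * x))) \<partial>lborel)"
  have "ennreal (Gamma (1 - \<alpha>)) =
      (\<integral>\<^sup>+x. ennreal (indicator {0..} x * x powr ((1 - \<alpha>) - 1) / exp x) \<partial>lborel)"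
    using assms by (intro Gamma_conv_nn_integral_real) auto
  also have "\<dots> = ennreal \<bar>\<theta>\<bar> * (\<integral>\<^sup>+x. ennreal (indicator {0..} (0 + \<theta> * x) * (0 + \<theta> * x) powr ((1 - \<alpha>) - 1) / exp (0 + \<theta> * x)) \<partial>lborel)"
    using assms by (intro nn_integral_real_affine) auto
  also have "(\<integral>\<^sup>+x. ennreal (indicator {0..} (0 + \<theta> * x) * (0 + \<theta> * x) powr ((1 - \<alpha>) - 1) / exp (0 + \<theta> * x)) \<partial>lborel)
     = (\<integral>\<^sup>+x. ennreal (\<theta> powr - \<alpha>) * ennreal (indicator {0<..} x * (x powr - \<alpha> * exp (- \<theta> * x))) \<partial>lborel)"
    using assms
    by (intro nn_integral_cong)
       (auto simp: indicator_def powr_mult exp_minus field_simps ennreal_mult'[symmetric] zero_le_mult_iff)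
  also have "\<dots> = ennreal (\<theta> powr - \<alpha>) * I"
    unfolding I_def by (intro nn_integral_cmult) auto
  finally have eq: "ennreal (Gamma (1 - \<alpha>)) = ennreal (\<theta> powr (1 - \<alpha>)) * I"
    using assms by (simp add: mult.assoc[symmetric] ennreal_mult'[symmetric] powr_diff powr_minus field_simps)
  have "ennreal (Gamma (1 - \<alpha>) * \<theta> powr (\<alpha> - 1)) = ennreal (\<theta> powr (\<alpha> - 1)) * ennreal (Gamma (1 - \<alpha>))"
    by (subst ennreal_mult'[symmetric]) (auto simp: mult.commute)
  also have "\<dots> = ennreal (\<theta> powr (\<alpha> - 1) * \<theta> powr (1 - \<alpha>)) * I"
    unfolding eq by (simp add: mult.assoc[symmetric] ennreal_mult'[symmetric])
  also have "\<theta> powr (\<alpha> - 1) * \<theta> powr (1 - \<alpha>) = 1"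
    using assms by (simp add: powr_add[symmetric])
  finally show ?thesis by (simp add: I_def)
qed

lemma integrable_powr_exp:
  assumes "\<alpha> < 1" "\<theta> > (0::real)"
  shows "integrable lborel (\<lambda>x. indicator {0<..} x * (x powr - \<alpha> * exp (- \<theta> * x)))"
proof (rule integrableI_nonneg)
  show "(\<integral>\<^sup>+ x. ennreal (indicator {0<..} x * (x powr - \<alpha> * exp (- \<theta> * x))) \<partial>lborel) < \<infinity>"
    unfolding nn_integral_powr_exp[OF assms] by simp
qed auto

lemma cts_levy_density_measurable [measurable]: "cts_levy_density \<alpha> \<beta> c \<in> borel_measurable borel"
  unfolding cts_levy_density_def[abs_def] by measurable

lemma cts_levy_density_nonneg: "c \<ge> 0 \<Longrightarrow> cts_levy_density \<alpha> \<beta> c x \<ge> 0"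
  by (simp add: cts_levy_density_def)

lemma cts_levy_density_scale: "cts_levy_density \<alpha> \<beta> (k * c) x = k * cts_levy_density \<alpha> \<beta> c x"
  by (simp add: cts_levy_density_def)

lemma cts_levy_density_first_moment:
  assumes "\<alpha> < 1" "\<beta> > 0"
  shows "integrable lborel (\<lambda>x. \<bar>x\<bar> * \<bar>cts_levy_density \<alpha> \<beta> c x\<bar>)"
proof -
  have "integrable lborel (\<lambda>x. \<bar>c\<bar> * (indicator {0<..} x * (x powr - \<alpha> * exp (- \<beta> * x))))"
    by (intro integrable_mult_right integrable_powr_exp assms)
  moreover have "\<bar>c\<bar> * (indicator {0<..} x * (x powr - \<alpha> * exp (- \<beta> * x))) = \<bar>x\<bar> * \<bar>cts_levy_density \<alpha> \<beta> c x\<bar>" for x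
    by (auto simp: cts_levy_density_def indicator_def powr_add powr_minus abs_mult field_simps)
  ultimately show ?thesis by (simp only:)
qed

text \<open>
  On the side of laws: if \<open>Z\<close> is tempered stable with parameters \<open>\<beta>\<close> and \<open>c\<close>, then \<open>\<kappa> * Z\<close> is tempered
  stable with parameters \<open>\<beta> / \<kappa>\<close> and \<open>c * \<kappa> powr \<alpha>\<close>.
\<close>

lemma cts_exponent_dilation:
  assumes "\<kappa> > 0"
  shows "levy_exponent (cts_levy_density \<alpha> \<beta> c) (\<kappa> * u) =
    levy_exponent (cts_levy_density \<alpha> (\<beta> / \<kappa>) (c * \<kappa> powr \<alpha>)) u"
proof -
  have "levy_exponent (cts_levy_density \<alpha> \<beta> c) (\<kappa> * u) = \<bar>1 / \<kappa>\<bar> *\<^sub>R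
     (CLINT x|lborel. (iexp (\<kappa> * u * (0 + (1 / \<kappa>) * x)) - 1) * complex_of_real (cts_levy_density \<alpha> \<beta> c (0 + (1 / \<kappa>) * x)))"
    unfolding levy_exponent_def using assms by (intro lborel_integral_real_affine) auto
  also have "\<dots> = (CLINT x|lborel. (1 / \<kappa>) *\<^sub>R ((iexp (\<kappa> * u * (0 + (1 / \<kappa>) * x)) - 1) * complex_of_real (cts_levy_density \<alpha> \<beta> c (0 + (1 / \<kappa>) * x))))"
    using assms by simp
  also have "\<dots> = levy_exponent (cts_levy_density \<alpha> (\<beta> / \<kappa>) (c * \<kappa> powr \<alpha>)) u"
    unfolding levy_exponent_def
  proof (intro Bochner_Integration.integral_cong refl)
    fix x :: real
    have 1: "iexp (\<kappa> * u * (0 + (1 / \<kappa>) * x)) = iexp (u * x)" using assms by simp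
    have 2: "(1 / \<kappa>) * cts_levy_density \<alpha> \<beta> c (0 + (1 / \<kappa>) * x) = cts_levy_density \<alpha> (\<beta> / \<kappa>) (c * \<kappa> powr \<alpha>) x"
      using assms by (auto simp: cts_levy_density_def powr_divide powr_add field_simps)
    show "(1 / \<kappa>) *\<^sub>R ((iexp (\<kappa> * u * (0 + (1 / \<kappa>) * x)) - 1) * complex_of_real (cts_levy_density \<alpha> \<beta> c (0 + (1 / \<kappa>) * x)))
      = (iexp (u * x) - 1) * complex_of_real (cts_levy_density \<alpha> (\<beta> / \<kappa>) (c * \<kappa> powr \<alpha>) x)"
      unfolding 1 2[symmetric] by (simp add: scaleR_conv_of_real)
  qed
  finally show ?thesis .
qed

text \<open>
  Cutting off the jumps smaller than \<open>1 / (n + 1)\<close> leaves a finite Levy density, hence a compound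
  Poisson law with positive jumps. Its exponent converges to that of \<open>\<mu>\<close> as \<open>n\<close> grows, so by the
  continuity theorem \<open>\<mu>\<close> is a weak limit of laws on the half line. The distribution function of \<open>\<mu>\<close> then
  vanishes at its negative continuity points, which are dense, and so on the whole negative axis.
\<close>

lemma cts_law_nonneg:
  assumes "cts_law \<alpha> \<beta> c \<mu>"
  shows "AE x in \<mu>. 0 \<le> x"
proof -
  from assms have \<alpha>: "\<alpha> < 1" and \<beta>: "\<beta> > 0" and c: "c > 0" and \<mu>: "real_distribution \<mu>"
    and char_\<mu>: "\<And>u. char \<mu> u = exp (levy_exponent (cts_levy_density \<alpha> \<beta> c) u)"
    unfolding cts_law_def levy_exponent_def by auto
  interpret \<mu>: real_distribution \<mu> by fact
  define \<nu> where "\<nu> = cts_levy_density \<alpha> \<beta> c"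
  have [measurable]: "\<nu> \<in> borel_measurable borel" unfolding \<nu>_def by measurable
  have \<nu>_nn: "\<nu> x \<ge> 0" for x unfolding \<nu>_def using c by (intro cts_levy_density_nonneg) auto
  have \<nu>_int: "integrable lborel (\<lambda>x. \<bar>x\<bar> * \<bar>\<nu> x\<bar>)"
    unfolding \<nu>_def by (rule cts_levy_density_first_moment[OF \<alpha> \<beta>])
  define \<nu>t where "\<nu>t = (\<lambda>n x. indicator {1 / real (Suc n)<..} x * \<nu> x)"
  have \<nu>t_meas[measurable]: "\<nu>t n \<in> borel_measurable borel" for n unfolding \<nu>t_def by measurable
  have \<nu>t_nn: "\<nu>t n x \<ge> 0" for n x unfolding \<nu>t_def using \<nu>_nn by simp
  have \<nu>t_le: "\<nu>t n x \<le> \<nu> x" for n x using \<nu>_nn[of x] by (auto simp: \<nu>t_def indicator_def)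
  have \<nu>t_int: "integrable lborel (\<nu>t n)" for n
  proof (rule Bochner_Integration.integrable_bound[of _ "\<lambda>x. real (Suc n) * (\<bar>x\<bar> * \<bar>\<nu> x\<bar>)"])
    show "integrable lborel (\<lambda>x. real (Suc n) * (\<bar>x\<bar> * \<bar>\<nu> x\<bar>))" using \<nu>_int by (rule integrable_mult_right)
    show "AE x in lborel. norm (\<nu>t n x) \<le> norm (real (Suc n) * (\<bar>x\<bar> * \<bar>\<nu> x\<bar>))"
    proof (rule AE_I2)
      fix x :: real
      show "norm (\<nu>t n x) \<le> norm (real (Suc n) * (\<bar>x\<bar> * \<bar>\<nu> x\<bar>))"
      proof (cases "x > 1 / real (Suc n)")
        case True
        then have "x > 0" by (rule less_trans[rotated]) simp
        with True have "real (Suc n) * \<bar>x\<bar> \<ge> 1" by (simp add: field_simps)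
        then have "1 * \<nu> x \<le> real (Suc n) * \<bar>x\<bar> * \<nu> x" using \<nu>_nn by (intro mult_right_mono) auto
        then show ?thesis using True \<nu>_nn[of x] by (simp add: \<nu>t_def abs_mult mult.assoc)
      qed (simp add: \<nu>t_def)
    qed
  qed simp
  define \<Lambda> where "\<Lambda> = (\<lambda>n. \<integral>x. \<nu>t n x \<partial>lborel)"
  have \<Lambda>_pos: "\<Lambda> n > 0" for n
  proof -
    have "\<Lambda> n \<noteq> 0"
    proof
      assume "\<Lambda> n = 0"
      then have "AE x in lborel. \<nu>t n x = 0"
        unfolding \<Lambda>_def using \<nu>t_int \<nu>t_nn by (subst (asm) integral_nonneg_eq_0_iff_AE) auto
      \<comment> \<open>The truncated density is positive beyond \<open>1\<close> for every \<open>n\<close>, so any bounded interval there will do.\<close>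
      then have "AE x in lborel. x \<notin> {1<..2::real}"
      proof eventually_elim
        case (elim x)
        have "1 / real (Suc n) \<le> 1" by simp
        then have "1 / real (Suc n) < x" if "1 < x" using that by linarith
        with elim c show ?case by (auto simp: \<nu>t_def \<nu>_def cts_levy_density_def indicator_def simp del: of_nat_Suc)
      qed
      then have "emeasure lborel {1<..2::real} = 0"
        by (subst (asm) AE_iff_measurable[of "{1<..2::real}"]) auto
      then show False by simp
    qed
    moreover have "\<Lambda> n \<ge> 0" unfolding \<Lambda>_def using \<nu>t_nn by (intro integral_nonneg_AE) auto
    ultimately show ?thesis by simp
  qed
  define f where "f = (\<lambda>n x. \<nu>t n x / \<Lambda> n)"
  have f_meas[measurable]: "f n \<in> borel_measurable borel" for n unfolding f_def by measurable
  have f_nn: "f n x \<ge> 0" for n x unfolding f_def using \<nu>t_nn \<Lambda>_pos[of n] by simp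
  have f_prob: "prob_space (density lborel (\<lambda>x. ennreal (f n x)))" for n
  proof (rule prob_spaceI)
    have "(\<integral>\<^sup>+x. ennreal (f n x) \<partial>lborel) = ennreal (\<integral>x. f n x \<partial>lborel)"
      using \<nu>t_int f_nn by (intro nn_integral_eq_integral) (auto simp: f_def)
    also have "(\<integral>x. f n x \<partial>lborel) = 1" using \<Lambda>_pos[of n] by (simp add: f_def \<Lambda>_def)
    finally show "emeasure (density lborel (\<lambda>x. ennreal (f n x))) (space (density lborel (\<lambda>x. ennreal (f n x)))) = 1"
      by (simp add: emeasure_density)
  qed
  have "\<exists>m. real_distribution m \<and> measure m {..<0} = 0 \<and> (\<forall>u. char m u = exp (levy_exponent (\<nu>t n) u))" for n
  proof -
    have r: "real_distribution (return borel (0::real))"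
      by (simp add: real_distribution_def real_distribution_axioms_def prob_space_return)
    from compound_poisson_exists[OF r r \<Lambda>_pos[of n] f_meas[of n] f_prob[of n]]
    obtain P :: "(nat \<Rightarrow> real) measure" and Y N J
      where P: "prob_space P" and cp: "compound_poisson P (\<Lambda> n) (f n) N J Y" by blast
    interpret P: prob_space P by fact
    have Ym[measurable]: "Y \<in> borel_measurable P" by (rule char_compound_poisson(2)[OF P cp])
    have "char (distr P borel Y) u = exp (levy_exponent (\<nu>t n) u)" for u
    proof -
      have "levy_exponent (\<nu>t n) u = levy_exponent (\<lambda>x. \<Lambda> n * f n x) u"
        using \<Lambda>_pos[of n] by (simp add: f_def)
      then show ?thesis
        unfolding char_compound_poisson(1)[OF P cp]
        by (simp add: levy_exponent_scale levy_exponent_prob_density[OF f_meas f_nn f_prob])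
    qed
    moreover have "AE \<omega> in P. 0 \<le> Y \<omega>"
    proof (rule compound_poisson_nonneg[OF P cp])
      fix x :: real assume "x < 0"
      then show "f n x = 0" by (simp add: f_def \<nu>t_def \<nu>_def cts_levy_density_def)
    qed simp
    then have "measure (distr P borel Y) {..<0} = 0"
      by (subst measure_distr) (auto simp: P.prob_eq_0)
    ultimately show ?thesis by (intro exI[of _ "distr P borel Y"]) auto
  qed
  then obtain m where m: "\<And>n. real_distribution (m n)" and m0: "\<And>n. measure (m n) {..<0} = 0"
    and char_m: "\<And>n u. char (m n) u = exp (levy_exponent (\<nu>t n) u)" by metis
  have conv: "(\<lambda>n. char (m n) u) \<longlonglongrightarrow> char \<mu> u" for u
    unfolding char_m char_\<mu> levy_exponent_def \<nu>_def[symmetric]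
  proof (intro tendsto_exp integral_dominated_convergence[where w="\<lambda>x. \<bar>u\<bar> * (\<bar>x\<bar> * \<bar>\<nu> x\<bar>)"])
    show "integrable lborel (\<lambda>x. \<bar>u\<bar> * (\<bar>x\<bar> * \<bar>\<nu> x\<bar>))" using \<nu>_int by simp
    show "AE x in lborel. (\<lambda>n. (iexp (u * x) - 1) * complex_of_real (\<nu>t n x)) \<longlonglongrightarrow> (iexp (u * x) - 1) * complex_of_real (\<nu> x)"
    proof (rule AE_I2)
      fix x :: real
      have "(\<lambda>n. \<nu>t n x) \<longlonglongrightarrow> \<nu> x"
      proof (cases "x > 0")
        case True
        then have "\<forall>\<^sub>F n in sequentially. 1 / real (Suc n) < x"
          using LIMSEQ_inverse_real_of_nat by (auto dest: order_tendstoD simp: inverse_eq_divide)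
        then have "\<forall>\<^sub>F n in sequentially. \<nu>t n x = \<nu> x" by eventually_elim (auto simp: \<nu>t_def)
        then show ?thesis by (rule tendsto_eventually)
      qed (simp add: \<nu>t_def \<nu>_def cts_levy_density_def)
      then show "(\<lambda>n. (iexp (u * x) - 1) * complex_of_real (\<nu>t n x)) \<longlonglongrightarrow> (iexp (u * x) - 1) * complex_of_real (\<nu> x)"
        by (intro tendsto_intros)
    qed
    show "AE x in lborel. norm ((iexp (u * x) - 1) * complex_of_real (\<nu>t n x)) \<le> \<bar>u\<bar> * (\<bar>x\<bar> * \<bar>\<nu> x\<bar>)" for n
    proof (rule AE_I2)
      fix x :: real
      have "norm (iexp (u * x) - 1) \<le> \<bar>u * x\<bar>" using norm_iexp_diff_le[of "u * x" 0] by simp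
      then have "norm (iexp (u * x) - 1) * \<bar>\<nu>t n x\<bar> \<le> \<bar>u * x\<bar> * \<bar>\<nu> x\<bar>"
        using \<nu>t_nn \<nu>t_le \<nu>_nn by (intro mult_mono) auto
      then show "norm ((iexp (u * x) - 1) * complex_of_real (\<nu>t n x)) \<le> \<bar>u\<bar> * (\<bar>x\<bar> * \<bar>\<nu> x\<bar>)"
        by (simp add: norm_mult abs_mult mult.assoc)
    qed
  qed simp_all
  have weak: "weak_conv_m m \<mu>" by (rule levy_continuity[OF m \<mu> conv])
  have cdf_m: "cdf (m n) x = 0" if "x < 0" for n x
  proof -
    interpret mn: real_distribution "m n" by (rule m)
    have "measure (m n) {..x} \<le> measure (m n) {..<0}"
      using that by (intro mn.finite_measure_mono) auto
    then show ?thesis using m0[of n] measure_nonneg[of "m n" "{..x}"] by (simp add: cdf_def)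
  qed
  have zero_cont: "cdf \<mu> x = 0" if "x < 0" "isCont (cdf \<mu>) x" for x
  proof -
    have "(\<lambda>n. cdf (m n) x) \<longlonglongrightarrow> cdf \<mu> x"
      using weak that(2) unfolding weak_conv_m_def weak_conv_def by auto
    then show ?thesis by (simp add: cdf_m[OF that(1)] LIMSEQ_const_iff)
  qed
  have zero: "cdf \<mu> x = 0" if "x < 0" for x
  proof -
    \<comment> \<open>Continuity points are the non-atoms, and there are only countably many atoms.\<close>
    have "countable {y. measure \<mu> {y} > 0}" by (rule \<mu>.countable_atoms)
    then have "uncountable ({x<..<0} - {y. measure \<mu> {y} > 0})"
      using that by (intro uncountable_minus_countable) (auto simp: uncountable_open_interval)
    then have "{x<..<0} - {y. measure \<mu> {y} > 0} \<noteq> {}" by (metis countable_empty)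
    then obtain y where "y \<in> {x<..<0} - {y. measure \<mu> {y} > 0}" by blast
    then have "x < y" "y < 0" "measure \<mu> {y} = 0" using measure_nonneg[of \<mu> "{y}"] by auto
    then have "cdf \<mu> x \<le> cdf \<mu> y" "cdf \<mu> y = 0"
      using \<mu>.cdf_nondecreasing[of x y] zero_cont[of y] by (auto simp: \<mu>.isCont_cdf)
    then show ?thesis using \<mu>.cdf_nonneg[of x] by simp
  qed
  have "(\<lambda>n. cdf \<mu> (- 1 / real (Suc n))) \<longlonglongrightarrow> measure \<mu> {..<0}"
  proof (rule filterlim_compose[OF \<mu>.cdf_at_left])
    have "(\<lambda>n. - inverse (real (Suc n))) \<longlonglongrightarrow> - 0"
      by (intro tendsto_minus LIMSEQ_inverse_real_of_nat)
    then show "filterlim (\<lambda>n. - 1 / real (Suc n)) (at_left 0) sequentially"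
      unfolding filterlim_at by (auto simp: inverse_eq_divide intro!: always_eventually)
  qed
  moreover have "cdf \<mu> (- 1 / real (Suc n)) = 0" for n by (rule zero) simp
  ultimately have "measure \<mu> {..<0} = 0" by (simp add: LIMSEQ_const_iff)
  then have "AE x in \<mu>. x \<notin> {..<0}" by (subst (asm) \<mu>.prob_eq_0) auto
  then show ?thesis by (auto simp: not_less)
qed

section \<open>Marginals and paths of the Levy process\<close>

text \<open>
  Rational approximation from strictly above which is monotone in \<open>x\<close>. Strictness makes it suitable for
  right-continuous functions; monotonicity carries inequalities from rational to real times.
\<close>

definition grid_above :: "nat \<Rightarrow> real \<Rightarrow> real" where
  "grid_above k x = real_of_int (\<lfloor>real (Suc k) * x\<rfloor> + 1) / real (Suc k)"

lemma grid_above_greater: "x < grid_above k x"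
proof -
  have "real (Suc k) * x < real_of_int (\<lfloor>real (Suc k) * x\<rfloor> + 1)" by linarith
  then show ?thesis unfolding grid_above_def by (simp add: pos_less_divide_eq mult.commute)
qed

lemma grid_above_le: "grid_above k x \<le> x + 1 / real (Suc k)"
proof -
  have "real_of_int (\<lfloor>real (Suc k) * x\<rfloor> + 1) \<le> real (Suc k) * x + 1" by linarith
  then have "grid_above k x \<le> (real (Suc k) * x + 1) / real (Suc k)"
    unfolding grid_above_def by (intro divide_right_mono) auto
  also have "\<dots> = x + 1 / real (Suc k)" by (simp add: add_divide_distrib)
  finally show ?thesis .
qed

lemma grid_above_mono: "x \<le> y \<Longrightarrow> grid_above k x \<le> grid_above k y"
  unfolding grid_above_def
  by (intro divide_right_mono) (auto intro!: floor_mono mult_left_mono)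

lemma grid_above_Rats: "grid_above k x \<in> \<rat>"
  unfolding grid_above_def by (intro Rats_divide) auto

lemma grid_above_tendsto: "(\<lambda>k. grid_above k x) \<longlonglongrightarrow> x"
proof (rule tendsto_sandwich)
  show "\<forall>\<^sub>F k in sequentially. x \<le> grid_above k x"
    using grid_above_greater by (auto intro: always_eventually less_imp_le)
  show "\<forall>\<^sub>F k in sequentially. grid_above k x \<le> x + 1 / real (Suc k)"
    using grid_above_le by (auto intro: always_eventually)
  show "(\<lambda>k. x + 1 / real (Suc k)) \<longlonglongrightarrow> x"
    using tendsto_add[OF tendsto_const LIMSEQ_inverse_real_of_nat, of x] by (simp add: inverse_eq_divide)
qed simp

lemma right_continuous_grid_above:
  fixes f :: "real \<Rightarrow> real"
  assumes "continuous (at_right x) f"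
  shows "(\<lambda>k. f (grid_above k x)) \<longlonglongrightarrow> f x"
proof -
  have "filterlim (\<lambda>k. grid_above k x) (at_right x) sequentially"
    unfolding filterlim_at using grid_above_tendsto grid_above_greater
    by (auto intro!: always_eventually simp: less_imp_neq[OF grid_above_greater, symmetric])
  then show ?thesis
    using assms unfolding continuous_within by (rule filterlim_compose[rotated])
qed

lemma char_distr_scale:
  assumes [measurable]: "X \<in> borel_measurable M"
  shows "char (distr M borel (\<lambda>\<omega>. k * X \<omega>)) u = char (distr M borel X) (k * u)"
  unfolding char_def by (subst (1 2) integral_distr) (auto simp: mult_ac)

lemma levy_process_weighted_increments_char:
  assumes L: "levy_process M L" and h: "h \<ge> 0"
  shows "char (distr M borel (\<lambda>\<omega>. \<Sum>i<n. w i * (L (real (Suc i) * h) \<omega> - L (real i * h) \<omega>))) u =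
    (\<Prod>i<n. char (distr M borel (L h)) (u * w i))"
proof -
  interpret prob_space M using L by (simp add: levy_process_def)
  have [measurable]: "L s \<in> borel_measurable M" if "s \<ge> 0" for s
    using L that by (simp add: levy_process_def)
  have "indep_vars (\<lambda>_. borel) (\<lambda>i \<omega>. L (real (Suc i) * h) \<omega> - L (real i * h) \<omega>) {..<n}"
  proof -
    have "\<forall>(\<tau> :: nat \<Rightarrow> real) n. 0 \<le> \<tau> 0 \<longrightarrow> (\<forall>i<n. \<tau> i \<le> \<tau> (Suc i)) \<longrightarrow>
        indep_vars (\<lambda>_. borel) (\<lambda>i \<omega>. L (\<tau> (Suc i)) \<omega> - L (\<tau> i) \<omega>) {..<n}"
      using L unfolding levy_process_def by blast
    note * = this[THEN spec[where x="\<lambda>i. real i * h"], THEN spec[where x=n], THEN mp, THEN mp]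
    show ?thesis by (rule *) (use h in \<open>auto intro!: mult_right_mono simp del: of_nat_Suc\<close>)
  qed
  then have "indep_vars (\<lambda>_. borel) (\<lambda>i \<omega>. w i * (L (real (Suc i) * h) \<omega> - L (real i * h) \<omega>)) {..<n}"
    by (rule indep_vars_compose2) auto
  then have "char (distr M borel (\<lambda>\<omega>. \<Sum>i<n. w i * (L (real (Suc i) * h) \<omega> - L (real i * h) \<omega>))) u =
      (\<Prod>i<n. char (distr M borel (\<lambda>\<omega>. w i * (L (real (Suc i) * h) \<omega> - L (real i * h) \<omega>))) u)"
    by (rule char_distr_sum)
  also have "\<dots> = (\<Prod>i<n. char (distr M borel (L h)) (u * w i))"
  proof (rule prod.cong)
    fix i
    have nn: "0 \<le> real i * h" "0 \<le> real (Suc i) * h" using h by auto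
    note m[measurable] = \<open>\<And>s. s \<ge> 0 \<Longrightarrow> L s \<in> borel_measurable M\<close>[OF nn(1)]
      \<open>\<And>s. s \<ge> 0 \<Longrightarrow> L s \<in> borel_measurable M\<close>[OF nn(2)] \<open>\<And>s. s \<ge> 0 \<Longrightarrow> L s \<in> borel_measurable M\<close>[OF h]
    have "\<forall>s\<ge>0. \<forall>h\<ge>0. distr M borel (\<lambda>\<omega>. L (s + h) \<omega> - L s \<omega>) = distr M borel (L h)"
      using L unfolding levy_process_def by blast
    from this[rule_format, of "real i * h" h] nn h
    have d: "distr M borel (\<lambda>\<omega>. L (real (Suc i) * h) \<omega> - L (real i * h) \<omega>) = distr M borel (L h)"
      by (simp add: algebra_simps)
    have "char (distr M borel (\<lambda>\<omega>. w i * (L (real (Suc i) * h) \<omega> - L (real i * h) \<omega>))) u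
       = char (distr M borel (\<lambda>\<omega>. L (real (Suc i) * h) \<omega> - L (real i * h) \<omega>)) (u * w i)"
      unfolding char_def by (subst (1 2) integral_distr) (use m in \<open>simp_all add: mult.assoc\<close>)
    then show "char (distr M borel (\<lambda>\<omega>. w i * (L (real (Suc i) * h) \<omega> - L (real i * h) \<omega>))) u
       = char (distr M borel (L h)) (u * w i)"
      unfolding d .
  qed simp
  finally show ?thesis .
qed

text \<open>
  \<open>L (n * h)\<close> is, up to \<open>L 0 = 0\<close>, the sum of \<open>n\<close> independent increments with the law of \<open>L h\<close>.
\<close>

lemma levy_process_char_multiple:
  assumes L: "levy_process M L" and h: "h \<ge> 0"
  shows "char (distr M borel (L (real n * h))) u = char (distr M borel (L h)) u ^ n"
proof -
  have [measurable]: "L s \<in> borel_measurable M" if "s \<ge> 0" for s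
    using L that by (simp add: levy_process_def)
  have L0: "AE \<omega> in M. L 0 \<omega> = 0" using L by (simp add: levy_process_def)
  have tele: "(\<Sum>i<n. 1 * (L (real (Suc i) * h) \<omega> - L (real i * h) \<omega>)) = L (real n * h) \<omega> - L 0 \<omega>" for \<omega>
    using sum_lessThan_telescope[of "\<lambda>i. L (real i * h) \<omega>" n] by simp
  have "distr M borel (L (real n * h)) = distr M borel (\<lambda>\<omega>. L (real n * h) \<omega> - L 0 \<omega>)"
    using h L0 by (intro distr_cong_AE) auto
  then show ?thesis
    using levy_process_weighted_increments_char[OF L h, of "\<lambda>_. 1" n u] unfolding tele by simp
qed

text \<open>
  An \<open>n\<close>-th root of a characteristic function is only determined up to an \<open>n\<close>-th root of unity at each
  point, but two continuous choices have a continuous quotient with finitely many values, which is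
  therefore constant, and equal to \<open>1\<close> because of the value at \<open>0\<close>.
\<close>

lemma char_unique_root:
  assumes \<mu>: "real_distribution \<mu>" and n: "n > 0" and c: "continuous_on UNIV \<eta>" and 0: "\<eta> 0 = 0"
    and pow: "\<And>u. char \<mu> u ^ n = exp (of_nat n * \<eta> u)"
  shows "char \<mu> u = exp (\<eta> u)"
proof -
  interpret real_distribution \<mu> by fact
  \<comment> \<open>The quotient of the two candidate roots.\<close>
  define r where "r = (\<lambda>u. char \<mu> u * exp (- \<eta> u))"
  have r: "r u ^ n = 1" for u
    unfolding r_def power_mult_distrib pow by (simp add: exp_of_nat_mult[symmetric] exp_add[symmetric])
  have "continuous_on UNIV (char \<mu>)"
    by (intro continuous_at_imp_continuous_on ballI isCont_char)
  then have "continuous_on UNIV r" unfolding r_def by (intro continuous_intros c)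
  moreover have "finite (range r)"
    by (rule finite_subset[OF _ finite_roots_unity[of n, where 'a=complex]]) (use n r in auto)
  ultimately have "r constant_on UNIV"
    by (intro continuous_finite_range_constant) auto
  then have "r u = r 0" by (auto simp: constant_on_def)
  also have "r 0 = 1" by (simp add: r_def 0 char_zero)
  finally show ?thesis by (simp add: r_def exp_minus field_simps)
qed

text \<open>
  For \<open>T / n\<close> this is the uniqueness of continuous roots, for rational multiples of \<open>T\<close> it follows by
  taking powers, and for all other times by right-continuity of the paths.
\<close>

lemma levy_process_char:
  assumes L: "levy_process M L" and T: "T > 0" and t: "t \<ge> 0"
    and c: "continuous_on UNIV \<psi>" and 0: "\<psi> 0 = 0"
    and char_T: "\<And>u. char (distr M borel (L T)) u = exp (\<psi> u)"
  shows "char (distr M borel (L t)) u = exp (complex_of_real (t / T) * \<psi> u)"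
proof -
  interpret prob_space M using L by (simp add: levy_process_def)
  have m[measurable]: "L s \<in> borel_measurable M" if "s \<ge> 0" for s
    using L that by (simp add: levy_process_def)
  have unit: "char (distr M borel (L (T / real n))) u = exp (\<psi> u / of_nat n)" if "n > 0" for n u
  proof (rule char_unique_root[of _ n "\<lambda>u. \<psi> u / of_nat n"])
    show "real_distribution (distr M borel (L (T / real n)))" using T by simp
    show "continuous_on UNIV (\<lambda>u. \<psi> u / of_nat n)" using that by (intro continuous_intros c) auto
    show "char (distr M borel (L (T / real n))) u ^ n = exp (of_nat n * (\<psi> u / of_nat n))" for u
      using levy_process_char_multiple[OF L, of "T / real n" n u] T that char_T by simp
  qed (use that 0 in auto)
  have rat: "char (distr M borel (L (real m * (T / real n)))) u = exp (complex_of_real (real m / real n) * \<psi> u)"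
    if "n > 0" for m n
    using levy_process_char_multiple[OF L, of "T / real n" m u] T that unit[OF that, of u]
    by (simp add: exp_of_nat_mult[symmetric] field_simps)
  define q where "q = (\<lambda>k. T * grid_above k (t / T))"
  have q_rat: "char (distr M borel (L (q k))) u = exp (complex_of_real (q k / T) * \<psi> u)" for k
  proof -
    have "\<lfloor>real (Suc k) * (t / T)\<rfloor> + 1 \<ge> 0" using t T by (simp add: add_nonneg_nonneg)
    then obtain p where p: "\<lfloor>real (Suc k) * (t / T)\<rfloor> + 1 = int p" by (metis nonneg_int_cases)
    have "q k = real p * (T / real (Suc k))" "q k / T = real p / real (Suc k)"
      unfolding q_def grid_above_def p using T by auto
    then show ?thesis using rat[of "Suc k" p] by simp
  qed
  have q_gt: "q k > t" for k
    using grid_above_greater[of "t / T" k] T unfolding q_def by (simp add: pos_divide_less_eq mult.commute)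
  have q_lim: "q \<longlonglongrightarrow> t"
    using tendsto_mult[OF tendsto_const grid_above_tendsto, of T "t / T"] T unfolding q_def by simp
  have "(\<lambda>k. \<integral>\<omega>. iexp (u * L (q k) \<omega>) \<partial>M) \<longlonglongrightarrow> (\<integral>\<omega>. iexp (u * L t \<omega>) \<partial>M)"
  proof (rule integral_dominated_convergence[where w="\<lambda>_. 1"])
    have "AE \<omega> in M. (\<forall>t\<ge>0. continuous (at_right t) (\<lambda>s. L s \<omega>))"
      using L unfolding levy_process_def by auto
    then show "AE \<omega> in M. (\<lambda>k. iexp (u * L (q k) \<omega>)) \<longlonglongrightarrow> iexp (u * L t \<omega>)"
    proof eventually_elim
      case (elim \<omega>)
      have "filterlim q (at_right t) sequentially"
        unfolding filterlim_at using q_lim q_gt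
        by (auto intro!: always_eventually simp: less_imp_neq[OF q_gt, symmetric])
      then have "(\<lambda>k. L (q k) \<omega>) \<longlonglongrightarrow> L t \<omega>"
        using elim[rule_format, OF t] unfolding continuous_within by (rule filterlim_compose[rotated])
      then show ?case by (intro tendsto_intros)
    qed
    have qn: "q k \<ge> 0" for k using q_gt[of k] t by simp
    show "(\<lambda>\<omega>. iexp (u * L (q k) \<omega>)) \<in> borel_measurable M" for k
      using m[OF qn, of k] by measurable
    show "(\<lambda>\<omega>. iexp (u * L t \<omega>)) \<in> borel_measurable M"
      using m[OF t] by measurable
  qed auto
  moreover have "(\<integral>\<omega>. iexp (u * L s \<omega>) \<partial>M) = char (distr M borel (L s)) u" if "s \<ge> 0" for s
    using m[OF that] unfolding char_def by (subst integral_distr) auto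
  ultimately have "(\<lambda>k. exp (complex_of_real (q k / T) * \<psi> u)) \<longlonglongrightarrow> char (distr M borel (L t)) u"
    using t q_gt q_rat by (simp add: less_imp_le order_trans[OF t less_imp_le[OF q_gt]])
  moreover have "(\<lambda>k. exp (complex_of_real (q k / T) * \<psi> u)) \<longlonglongrightarrow> exp (complex_of_real (t / T) * \<psi> u)"
    using T by (intro tendsto_intros q_lim) auto
  ultimately show ?thesis by (rule LIMSEQ_unique)
qed

text \<open>
  For two fixed times the inequality holds almost surely; countably many pairs of rational times have a
  common exceptional null set, and right-continuity extends the inequality to all times.
\<close>

lemma levy_process_nondecreasing_paths:
  assumes L: "levy_process M L" and nn: "\<And>h. h \<ge> 0 \<Longrightarrow> AE x in distr M borel (L h). 0 \<le> x"
  shows "AE \<omega> in M. \<forall>s t. 0 \<le> s \<longrightarrow> s \<le> t \<longrightarrow> L s \<omega> \<le> L t \<omega>"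
proof -
  have m: "L s \<in> borel_measurable M" if "s \<ge> 0" for s
    using L that by (simp add: levy_process_def)
  have pair: "AE \<omega> in M. L s \<omega> \<le> L t \<omega>" if "0 \<le> s" "s \<le> t" for s t
  proof -
    have "\<forall>s\<ge>0. \<forall>h\<ge>0. distr M borel (\<lambda>\<omega>. L (s + h) \<omega> - L s \<omega>) = distr M borel (L h)"
      using L unfolding levy_process_def by blast
    from this[THEN spec[where x=s], THEN mp, THEN spec[where x="t - s"], THEN mp] that
    have "distr M borel (\<lambda>\<omega>. L (s + (t - s)) \<omega> - L s \<omega>) = distr M borel (L (t - s))"
      by simp
    then have d: "distr M borel (\<lambda>\<omega>. L t \<omega> - L s \<omega>) = distr M borel (L (t - s))" by simp
    have "AE x in distr M borel (\<lambda>\<omega>. L t \<omega> - L s \<omega>). 0 \<le> x"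
      unfolding d using that by (intro nn) simp
    then have "AE \<omega> in M. 0 \<le> L t \<omega> - L s \<omega>"
      by (rule AE_distrD[rotated]) (use m[of t] m[of s] that in auto)
    then show ?thesis by simp
  qed
  have "AE \<omega> in M. \<forall>s\<in>\<rat>. \<forall>t\<in>\<rat>. 0 \<le> s \<longrightarrow> s \<le> t \<longrightarrow> L s \<omega> \<le> L t \<omega>"
    by (intro AE_ball_countable' countable_rat) (auto intro!: AE_impI pair)
  moreover have "AE \<omega> in M. \<forall>t\<ge>0. continuous (at_right t) (\<lambda>s. L s \<omega>)"
    using L unfolding levy_process_def by auto
  ultimately show ?thesis
  proof eventually_elim
    case (elim \<omega>)
    show ?case
    proof (intro allI impI)
      fix s t :: real assume st: "0 \<le> s" "s \<le> t"
      show "L s \<omega> \<le> L t \<omega>"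
      proof (rule LIMSEQ_le)
        show "(\<lambda>k. L (grid_above k s) \<omega>) \<longlonglongrightarrow> L s \<omega>" "(\<lambda>k. L (grid_above k t) \<omega>) \<longlonglongrightarrow> L t \<omega>"
          using elim(2) st by (auto intro!: right_continuous_grid_above[where f="\<lambda>s. L s \<omega>"])
        have "L (grid_above k s) \<omega> \<le> L (grid_above k t) \<omega>" for k
          using elim(1) grid_above_Rats grid_above_mono[OF st(2)] grid_above_greater[of s k] st(1)
          by (auto simp: less_imp_le)
        then show "\<exists>N. \<forall>k\<ge>N. L (grid_above k s) \<omega> \<le> L (grid_above k t) \<omega>" by auto
      qed
    qed
  qed
qed

section \<open>The characteristic function of the solution\<close>

text \<open>
  For \<open>F x = x\<close> these are ordinary Riemann sums. The lemma is used twice: for the paths of the process,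
  where \<open>g\<close> is the exponential kernel, and for Lebesgue measure, where \<open>g\<close> is the complex-valued
  exponent in the characteristic functions of the very same sums.
\<close>

lemma stieltjes_sums_tendsto:
  fixes F :: "real \<Rightarrow> real" and g :: "real \<Rightarrow> 'b :: {banach, second_countable_topology}"
  assumes mono: "\<And>x y. x \<le> y \<Longrightarrow> F x \<le> F y" and rc: "\<And>x. continuous (at_right x) F"
    and t: "t > 0" and g: "continuous_on {0..t} g"
  shows "(\<lambda>n. \<Sum>i<Suc n. (F (real (Suc i) * (t / Suc n)) - F (real i * (t / Suc n))) *\<^sub>R g (real (Suc i) * (t / Suc n)))
     \<longlonglongrightarrow> set_lebesgue_integral (interval_measure F) {0<..t} g"
proof -
  define \<mu> where "\<mu> = interval_measure F"
  have [simp, measurable_cong]: "sets \<mu> = sets borel" by (simp add: \<mu>_def)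
  have space_\<mu>: "space \<mu> = UNIV" by (simp add: \<mu>_def)
  define h where "h = (\<lambda>n. t / real (Suc n))"
  have h: "h n > 0" for n using t by (simp add: h_def)
  define cell where "cell = (\<lambda>n i. {real i * h n<..real (Suc i) * h n})"
  \<comment> \<open>The step function whose integral is the \<open>n\<close>-th sum: the value of \<open>g\<close> at the right end of each cell.\<close>
  define s where "s = (\<lambda>n x. \<Sum>i<Suc n. indicator (cell n i) x *\<^sub>R g (real (Suc i) * h n))"
  have meas_cell: "measure \<mu> (cell n i) = F (real (Suc i) * h n) - F (real i * h n)"
    and fin_cell: "emeasure \<mu> (cell n i) < \<infinity>" for n i
    using h[of n] mono rc unfolding \<mu>_def cell_def
    by (auto simp: measure_interval_measure_Ioc emeasure_interval_measure_Ioc mult_right_mono)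
  have int_s: "integral\<^sup>L \<mu> (s n) = (\<Sum>i<Suc n. (F (real (Suc i) * h n) - F (real i * h n)) *\<^sub>R g (real (Suc i) * h n))" for n
    unfolding s_def
  proof (subst Bochner_Integration.integral_sum)
    show "integrable \<mu> (\<lambda>x. indicator (cell n i) x *\<^sub>R g (real (Suc i) * h n))" for i
      using fin_cell[of n i] by (intro integrable_scaleR_left integrable_real_indicator) (auto simp: cell_def)
    show "(\<Sum>i<Suc n. \<integral>x. indicator (cell n i) x *\<^sub>R g (real (Suc i) * h n) \<partial>\<mu>) =
        (\<Sum>i<Suc n. (F (real (Suc i) * h n) - F (real i * h n)) *\<^sub>R g (real (Suc i) * h n))"
    proof (rule sum.cong)
      fix i
      have "integrable \<mu> (indicat_real (cell n i))"
        using fin_cell[of n i] by (intro integrable_real_indicator) (auto simp: cell_def)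
      then show "(\<integral>x. indicator (cell n i) x *\<^sub>R g (real (Suc i) * h n) \<partial>\<mu>) =
         (F (real (Suc i) * h n) - F (real i * h n)) *\<^sub>R g (real (Suc i) * h n)"
        by (subst integral_scaleR_left) (simp_all add: meas_cell space_\<mu> del: of_nat_Suc)
    qed simp
  qed
  have nh: "real (Suc n) * h n = t" for n by (simp add: h_def)
  have s_in: "\<exists>y\<in>{0..t}. s n x = g y \<and> \<bar>y - x\<bar> \<le> h n" if x: "0 < x" "x \<le> t" for n x
  proof -
    \<comment> \<open>The index of the only cell that contains \<open>x\<close>; cells are open on the left and closed on the right.\<close>
    define i where "i = nat (\<lceil>x / h n\<rceil> - 1)"
    have pos: "\<lceil>x / h n\<rceil> \<ge> 1" using x h[of n] by simp
    have ri: "real i = real_of_int \<lceil>x / h n\<rceil> - 1" unfolding i_def using pos by simp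
    have lo: "real i < x / h n" and hi: "x / h n \<le> real i + 1" unfolding ri by linarith+
    have lo': "real i * h n < x" using lo h[of n] by (simp add: pos_less_divide_eq)
    have hi': "x \<le> real (Suc i) * h n" using hi h[of n] by (simp add: pos_divide_le_eq add.commute)
    have "x / h n \<le> real (Suc n)" using x nh[of n] h[of n] by (simp add: pos_divide_le_eq)
    then have "real i < real (Suc n)" using lo by linarith
    then have i: "i < Suc n" by simp
    have uniq: "indicator (cell n j) x = (if j = i then 1 else (0::real))" for j
    proof (cases "j = i")
      case True
      have "x \<in> cell n i" using lo' hi' unfolding cell_def by simp
      with True show ?thesis by simp
    next
      case False
      have "x \<notin> cell n j"
      proof
        assume "x \<in> cell n j"
        then have "real j * h n < x" "x \<le> real (Suc j) * h n" by (simp_all only: cell_def greaterThanAtMost_iff)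
        then have "real j * h n < real (Suc i) * h n" "real i * h n < real (Suc j) * h n"
          using lo' hi' by linarith+
        then have "real j < real (Suc i)" "real i < real (Suc j)"
          using h[of n] by (simp_all only: mult_less_cancel_right_pos)
        then show False using False by linarith
      qed
      with False show ?thesis by simp
    qed
    have "s n x = g (real (Suc i) * h n)"
      unfolding s_def uniq using i by (simp add: if_distrib[of "\<lambda>c. c *\<^sub>R _"] sum.delta cong: if_cong)
    moreover have "real (Suc i) * h n \<in> {0..t}"
    proof -
      have "real (Suc i) * h n \<le> real (Suc n) * h n" using i h[of n] by (intro mult_right_mono) auto
      then show ?thesis using nh[of n] h[of n] by (auto simp: less_imp_le)
    qed
    moreover have "\<bar>real (Suc i) * h n - x\<bar> \<le> h n" using lo' hi' by (auto simp: algebra_simps abs_le_iff)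
    ultimately show ?thesis by blast
  qed
  have s_out: "s n x = 0" if "x \<notin> {0<..t}" for n x
    unfolding s_def
  proof (rule sum.neutral, rule ballI)
    fix i assume i: "i \<in> {..<Suc n}"
    have "real (Suc i) * h n \<le> real (Suc n) * h n" using i h[of n] by (intro mult_right_mono) auto
    moreover have "real i * h n \<ge> 0" using h[of n] by simp
    ultimately have "x \<notin> cell n i" using that nh[of n] by (auto simp: cell_def)
    then show "indicator (cell n i) x *\<^sub>R g (real (Suc i) * h n) = 0" by simp
  qed
  have "compact (g ` {0..t})" by (intro compact_continuous_image g) auto
  then have "bounded (g ` {0..t})" by (rule compact_imp_bounded)
  then obtain B where "\<forall>z\<in>g ` {0..t}. norm z \<le> B"
    unfolding bounded_iff by blast
  then have B: "norm (g y) \<le> B" if "y \<in> {0..t}" for y using that by blast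
  have B0: "B \<ge> 0" using order_trans[OF norm_ge_zero B[of 0]] t by simp
  have "(\<lambda>n. integral\<^sup>L \<mu> (s n)) \<longlonglongrightarrow> (\<integral>x. indicator {0<..t} x *\<^sub>R g x \<partial>\<mu>)"
  proof (rule integral_dominated_convergence[where w="\<lambda>x. B * indicator {0<..t} x"])
    have "continuous_on {0<..t} g" by (rule continuous_on_subset[OF g]) auto
    then have "(\<lambda>x. indicator {0<..t} x *\<^sub>R g x) \<in> borel_measurable borel"
      by (intro borel_measurable_continuous_on_indicator) auto
    then show "(\<lambda>x. indicator {0<..t} x *\<^sub>R g x) \<in> borel_measurable \<mu>" by simp
    show "s n \<in> borel_measurable \<mu>" for n unfolding s_def cell_def by measurable
    have "emeasure \<mu> {0<..t} < \<infinity>"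
      unfolding \<mu>_def using t mono rc by (simp add: emeasure_interval_measure_Ioc)
    then show "integrable \<mu> (\<lambda>x. B * indicator {0<..t} x)"
      by (intro integrable_mult_right integrable_real_indicator) auto
    show "AE x in \<mu>. norm (s n x) \<le> B * indicator {0<..t} x" for n
    proof (rule AE_I2)
      fix x
      show "norm (s n x) \<le> B * indicator {0<..t} x"
        using s_in[of x n] s_out[of x n] B by (cases "x \<in> {0<..t}") auto
    qed
    show "AE x in \<mu>. (\<lambda>n. s n x) \<longlonglongrightarrow> indicator {0<..t} x *\<^sub>R g x"
    proof (rule AE_I2)
      fix x
      show "(\<lambda>n. s n x) \<longlonglongrightarrow> indicator {0<..t} x *\<^sub>R g x"
      proof (cases "x \<in> {0<..t}")
        case True
        then obtain y where y: "\<And>n. y n \<in> {0..t}" "\<And>n. s n x = g (y n)" "\<And>n. \<bar>y n - x\<bar> \<le> h n"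
          using s_in[of x] by (auto simp: Bex_def) metis
        have "h \<longlonglongrightarrow> 0"
          using tendsto_mult[OF tendsto_const LIMSEQ_inverse_real_of_nat, of t] by (simp add: h_def[abs_def] divide_inverse)
        then have "(\<lambda>n. y n - x) \<longlonglongrightarrow> 0"
          by (rule Lim_null_comparison[rotated]) (use y(3) in auto)
        then have "y \<longlonglongrightarrow> x" by (simp add: LIM_zero_iff)
        then have "(\<lambda>n. g (y n)) \<longlonglongrightarrow> g x"
          using g True y(1) unfolding continuous_on_sequentially comp_def by auto
        then show ?thesis using True y(2) by simp
      qed (simp add: s_out)
    qed
  qed
  then show ?thesis unfolding int_s unfolding set_lebesgue_integral_def \<mu>_def h_def .
qed

lemma set_integral_Icc_eq_Ioc:
  fixes g :: "real \<Rightarrow> 'b :: {banach, second_countable_topology}"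
  assumes "continuous_on {a..b} g"
  shows "set_lebesgue_integral lborel {a<..b} g = set_lebesgue_integral lborel {a..b} g"
  unfolding set_lebesgue_integral_def
proof (rule integral_cong_AE)
  have "continuous_on {a<..b} g" by (rule continuous_on_subset[OF assms]) auto
  then have "(\<lambda>x. indicator {a<..b} x *\<^sub>R g x) \<in> borel_measurable borel"
    by (intro borel_measurable_continuous_on_indicator) auto
  then show "(\<lambda>x. indicator {a<..b} x *\<^sub>R g x) \<in> borel_measurable lborel" by simp
  have "(\<lambda>x. indicator {a..b} x *\<^sub>R g x) \<in> borel_measurable borel"
    by (intro borel_measurable_continuous_on_indicator assms) auto
  then show "(\<lambda>x. indicator {a..b} x *\<^sub>R g x) \<in> borel_measurable lborel" by simp
  have "AE x in lborel. x \<noteq> a" by (rule AE_lborel_singleton)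
  then show "AE x in lborel. indicator {a<..b} x *\<^sub>R g x = indicator {a..b} x *\<^sub>R g x"
    by eventually_elim (simp add: indicator_def)
qed

text \<open>
  The \<open>n\<close>-th Riemann-Stieltjes sum is a weighted sum of independent increments over a time step
  \<open>t / (n + 1)\<close>, so its exponent is itself a Riemann sum of the time integral on the right-hand side.
\<close>

lemma OU_solution_char:
  assumes L: "levy_process M L" and b: "b > 0" and T: "T > 0" and t: "t > 0"
    and paths: "AE \<omega> in M. \<forall>s t. 0 \<le> s \<longrightarrow> s \<le> t \<longrightarrow> L s \<omega> \<le> L t \<omega>"
    and X0[measurable]: "X0 \<in> borel_measurable M"
    and ind: "indep_rv M borel X0 (Pi\<^sub>M {0..} (\<lambda>_. borel)) (\<lambda>\<omega>. \<lambda>s\<in>{0..}. L s \<omega>)"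
    and X: "OU_solution M b X0 L X"
    and char_L: "\<And>s u. s \<ge> 0 \<Longrightarrow> char (distr M borel (L s)) u = exp (complex_of_real (s / T) * \<psi> u)"
    and \<psi>: "continuous_on UNIV \<psi>"
  shows "char (distr M borel (X t)) u = char (distr M borel X0) (u * exp (- b * t)) *
    exp (complex_of_real (1 / T) * (CLINT s:{0..t}|lborel. \<psi> (u * exp (- b * (t - s)))))"
proof -
  interpret prob_space M using L by (simp add: levy_process_def)
  have m: "L s \<in> borel_measurable M" if "s \<ge> 0" for s
    using L that by (simp add: levy_process_def)
  have Xm[measurable]: "X t \<in> borel_measurable M"
    and X_eq: "AE \<omega> in M. X t \<omega> = X0 \<omega> * exp (- b * t) + stieltjes_integral L (\<lambda>s. exp (- b * (t - s))) t \<omega>"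
    using X t unfolding OU_solution_def by auto
  define f where "f = (\<lambda>s. exp (- b * (t - s)))"
  have f_cont: "continuous_on S f" for S unfolding f_def by (intro continuous_intros)
  define h where "h = (\<lambda>n. t / real (Suc n))"
  have h: "h n > 0" for n using t by (simp add: h_def)
  define I where "I = (\<lambda>n \<omega>. \<Sum>i<Suc n. f (real (Suc i) * h n) * (L (real (Suc i) * h n) \<omega> - L (real i * h n) \<omega>))"
  have nn: "real i * h n \<ge> 0" for i n using h[of n] by simp
  have I_meas[measurable]: "I n \<in> borel_measurable M" for n
    unfolding I_def by (intro borel_measurable_sum borel_measurable_times borel_measurable_diff m nn) auto
  have I_conv: "AE \<omega> in M. (\<lambda>n. I n \<omega>) \<longlonglongrightarrow> stieltjes_integral L f t \<omega>"
  proof -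
    have "AE \<omega> in M. \<forall>t\<ge>0. continuous (at_right t) (\<lambda>s. L s \<omega>)"
      using L unfolding levy_process_def by auto
    with paths show ?thesis
    proof eventually_elim
      case (elim \<omega>)
      define F where "F = (\<lambda>s. L (max 0 s) \<omega>)"
      have mono: "F x \<le> F y" if "x \<le> y" for x y
        unfolding F_def using elim(1) that by (auto simp: max_def)
      have rc: "continuous (at_right x) F" for x
      proof (cases "x \<ge> 0")
        case True
        then have "continuous (at_right x) (\<lambda>s. L s \<omega>)" using elim(2) by blast
        then have "((\<lambda>s. L s \<omega>) \<longlongrightarrow> L x \<omega>) (at_right x)" by (simp add: continuous_within)
        moreover have "\<forall>\<^sub>F s in at_right x. L s \<omega> = F s"
          using True by (auto simp: eventually_at_filter F_def max_def intro!: always_eventually)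
        ultimately have "(F \<longlongrightarrow> L x \<omega>) (at_right x)" by (rule Lim_transform_eventually)
        then show ?thesis using True by (simp add: continuous_within F_def max_def)
      next
        case False
        have "\<forall>\<^sub>F s in at_right x. s < 0"
          using False by (intro eventually_at_rightI[of x 0]) auto
        then have "\<forall>\<^sub>F s in at_right x. F s = F x"
          by eventually_elim (use False in \<open>simp add: F_def max_def\<close>)
        then show ?thesis unfolding continuous_within by (rule tendsto_eventually)
      qed
      have "(\<lambda>n. \<Sum>i<Suc n. (F (real (Suc i) * (t / Suc n)) - F (real i * (t / Suc n))) *\<^sub>R f (real (Suc i) * (t / Suc n)))
         \<longlonglongrightarrow> set_lebesgue_integral (interval_measure F) {0<..t} f"
        by (rule stieltjes_sums_tendsto[OF mono rc t f_cont])
      moreover have "F (real i * h n) = L (real i * h n) \<omega>" for i n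
        using nn[of i n] by (simp only: F_def max_absorb2)
      ultimately show ?case
        unfolding stieltjes_integral_def F_def[symmetric] I_def h_def by (simp only: real_scaleR_def mult.commute)
    qed
  qed
  have char_I: "char (distr M borel (I n)) u =
      exp (complex_of_real (1 / T) * (\<Sum>i<Suc n. (real (Suc i) * h n - real i * h n) *\<^sub>R \<psi> (u * f (real (Suc i) * h n))))" for n
  proof -
    have "char (distr M borel (I n)) u = (\<Prod>i<Suc n. char (distr M borel (L (h n))) (u * f (real (Suc i) * h n)))"
      unfolding I_def using h[of n] by (intro levy_process_weighted_increments_char[OF L]) simp
    also have "\<dots> = (\<Prod>i<Suc n. exp (complex_of_real (h n / T) * \<psi> (u * f (real (Suc i) * h n))))"
      using h[of n] by (intro prod.cong refl char_L) simp
    also have "\<dots> = exp (\<Sum>i<Suc n. complex_of_real (h n / T) * \<psi> (u * f (real (Suc i) * h n)))"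
      by (rule exp_sum[symmetric]) simp
    also have "(\<Sum>i<Suc n. complex_of_real (h n / T) * \<psi> (u * f (real (Suc i) * h n))) =
       complex_of_real (1 / T) * (\<Sum>i<Suc n. (real (Suc i) * h n - real i * h n) *\<^sub>R \<psi> (u * f (real (Suc i) * h n)))"
      unfolding sum_distrib_left
    proof (intro sum.cong refl)
      fix i
      have "real (Suc i) * h n - real i * h n = h n" by (simp add: algebra_simps)
      then show "complex_of_real (h n / T) * \<psi> (u * f (real (Suc i) * h n)) =
          complex_of_real (1 / T) * ((real (Suc i) * h n - real i * h n) *\<^sub>R \<psi> (u * f (real (Suc i) * h n)))"
        by (simp only: scaleR_conv_of_real) simp
    qed
    finally show ?thesis .
  qed
  have "continuous_on {0..t} (\<lambda>s. \<psi> (u * f s))"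
    by (intro continuous_on_compose2[OF \<psi>] continuous_intros f_cont) auto
  then have sums: "(\<lambda>n. \<Sum>i<Suc n. (real (Suc i) * h n - real i * h n) *\<^sub>R \<psi> (u * f (real (Suc i) * h n)))
      \<longlonglongrightarrow> (CLINT s:{0..t}|lborel. \<psi> (u * f s))"
    using stieltjes_sums_tendsto[of "\<lambda>x. x" t "\<lambda>s. \<psi> (u * f s)"] t
    unfolding h_def lborel_eq_real[symmetric]
    by (simp only: set_integral_Icc_eq_Ioc continuous_ident)
  have prod: "(\<integral>\<omega>. iexp (u * (X0 \<omega> * exp (- b * t) + I n \<omega>)) \<partial>M) =
      char (distr M borel X0) (u * exp (- b * t)) * char (distr M borel (I n)) u" for n
  proof -
    \<comment> \<open>The sum as a functional of the whole path, to which the independence of \<open>X0\<close> and \<open>L\<close> applies.\<close>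
    define G where "G = (\<lambda>p :: real \<Rightarrow> real. iexp (u * (\<Sum>i<Suc n. f (real (Suc i) * h n) * (p (real (Suc i) * h n) - p (real i * h n)))))"
    have G: "G (\<lambda>s\<in>{0..}. L s \<omega>) = iexp (u * I n \<omega>)" for \<omega>
      unfolding G_def I_def by (simp only: restrict_apply atLeast_iff nn if_True)
    have G_meas: "G \<in> borel_measurable (Pi\<^sub>M {0..} (\<lambda>_. borel))"
    proof -
      have [measurable]: "(\<lambda>p. p (real i * h n)) \<in> borel_measurable (Pi\<^sub>M {0..} (\<lambda>_. borel :: real measure))" for i
        by (rule measurable_component_singleton) (use nn in auto)
      show ?thesis unfolding G_def by measurable
    qed
    have "(\<integral>\<omega>. iexp (u * (X0 \<omega> * exp (- b * t) + I n \<omega>)) \<partial>M) =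
        (\<integral>\<omega>. iexp (u * exp (- b * t) * X0 \<omega>) * G (\<lambda>s\<in>{0..}. L s \<omega>) \<partial>M)"
      unfolding G by (intro Bochner_Integration.integral_cong) (auto simp: exp_add[symmetric] algebra_simps)
    also have "\<dots> = (\<integral>\<omega>. iexp (u * exp (- b * t) * X0 \<omega>) \<partial>M) * (\<integral>\<omega>. G (\<lambda>s\<in>{0..}. L s \<omega>) \<partial>M)"
    proof (rule integral_indep_rv_mult[OF ind _ G_meas])
      show "integrable M (\<lambda>\<omega>. iexp (u * exp (- b * t) * X0 \<omega>))" by (intro integrable_iexp) auto
      show "integrable M (\<lambda>\<omega>. G (\<lambda>s\<in>{0..}. L s \<omega>))" unfolding G by (intro integrable_iexp) auto
    qed simp
    also have "(\<integral>\<omega>. G (\<lambda>s\<in>{0..}. L s \<omega>) \<partial>M) = char (distr M borel (I n)) u"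
      unfolding G char_def by (subst integral_distr) auto
    also have "(\<integral>\<omega>. iexp (u * exp (- b * t) * X0 \<omega>) \<partial>M) = char (distr M borel X0) (u * exp (- b * t))"
      unfolding char_def by (subst integral_distr) auto
    finally show ?thesis .
  qed
  have "(\<lambda>n. \<integral>\<omega>. iexp (u * (X0 \<omega> * exp (- b * t) + I n \<omega>)) \<partial>M) \<longlonglongrightarrow> (\<integral>\<omega>. iexp (u * X t \<omega>) \<partial>M)"
  proof (rule integral_dominated_convergence[where w="\<lambda>_. 1"])
    show "AE \<omega> in M. (\<lambda>n. iexp (u * (X0 \<omega> * exp (- b * t) + I n \<omega>))) \<longlonglongrightarrow> iexp (u * X t \<omega>)"
      using I_conv X_eq
    proof eventually_elim
      case (elim \<omega>)
      show ?case unfolding elim(2) f_def[symmetric] by (intro tendsto_intros elim(1))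
    qed
  qed auto
  moreover have "(\<lambda>n. \<integral>\<omega>. iexp (u * (X0 \<omega> * exp (- b * t) + I n \<omega>)) \<partial>M) \<longlonglongrightarrow>
     char (distr M borel X0) (u * exp (- b * t)) * exp (complex_of_real (1 / T) * (CLINT s:{0..t}|lborel. \<psi> (u * f s)))"
    unfolding prod char_I by (intro tendsto_intros sums)
  ultimately have "(\<integral>\<omega>. iexp (u * X t \<omega>) \<partial>M) = 
      char (distr M borel X0) (u * exp (- b * t)) * exp (complex_of_real (1 / T) * (CLINT s:{0..t}|lborel. \<psi> (u * f s)))"
    by (rule LIMSEQ_unique)
  moreover have "(\<integral>\<omega>. iexp (u * X t \<omega>) \<partial>M) = char (distr M borel (X t)) u"
    unfolding char_def by (subst integral_distr) auto
  ultimately show ?thesis by (simp add: f_def)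
qed

section \<open>The primitive of a power and the weight of the jumps\<close>

text \<open>
  The integral of \<open>w powr (- 1 - \<alpha>)\<close> over \<open>1 \<le> w \<le> v\<close>; the case \<open>\<alpha> = 0\<close> continues the other one.
\<close>

definition powr_primitive :: "real \<Rightarrow> real \<Rightarrow> real" where
  "powr_primitive \<alpha> v = (if \<alpha> = 0 then ln v else (1 - v powr - \<alpha>) / \<alpha>)"

lemma powr_primitive_1 [simp]: "powr_primitive \<alpha> 1 = 0"
  by (simp add: powr_primitive_def)

lemma powr_primitive_has_real_derivative:
  assumes "v > 0"
  shows "(powr_primitive \<alpha> has_real_derivative v powr (- 1 - \<alpha>)) (at v within S)"
proof (cases "\<alpha> = 0")
  case True
  then have "powr_primitive \<alpha> = ln" by (auto simp: powr_primitive_def)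
  moreover have "(ln has_real_derivative v powr (- 1 - \<alpha>)) (at v within S)"
    using assms True by (auto intro!: derivative_eq_intros simp: powr_minus inverse_eq_divide)
  ultimately show ?thesis by simp
next
  case False
  then have "powr_primitive \<alpha> = (\<lambda>v. (1 - v powr - \<alpha>) / \<alpha>)" by (auto simp: powr_primitive_def)
  moreover have "((\<lambda>v. (1 - v powr - \<alpha>) / \<alpha>) has_real_derivative v powr (- 1 - \<alpha>)) (at v within S)"
  proof -
    have "((\<lambda>v. (1 - v powr - \<alpha>) / \<alpha>) has_real_derivative (0 - (- \<alpha>) * v powr (- \<alpha> - 1)) / \<alpha>) (at v within S)"
      by (intro DERIV_cdivide DERIV_diff DERIV_const DERIV_subset[OF has_real_derivative_powr[OF assms]]) auto
    moreover have "(0 - (- \<alpha>) * v powr (- \<alpha> - 1)) / \<alpha> = v powr (- 1 - \<alpha>)"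
      using False by (simp add: minus_diff_commute)
    ultimately show ?thesis by simp
  qed
  ultimately show ?thesis by simp
qed

lemma powr_primitive_continuous: "S \<subseteq> {0<..} \<Longrightarrow> continuous_on S (powr_primitive \<alpha>)"
  by (intro DERIV_continuous_on[where D="\<lambda>v. v powr (- 1 - \<alpha>)"] powr_primitive_has_real_derivative) auto

lemma powr_primitive_pos:
  assumes "v > 1" shows "powr_primitive \<alpha> v > 0"
proof (rule DERIV_pos_imp_increasing[of 1 v "powr_primitive \<alpha>", simplified])
  show "1 < v" by fact
  show "\<And>x. 1 \<le> x \<Longrightarrow> x \<le> v \<Longrightarrow> \<exists>y. (powr_primitive \<alpha> has_real_derivative y) (at x) \<and> 0 < y"
  proof -
    fix x :: real assume "1 \<le> x"
    then show "\<exists>y. (powr_primitive \<alpha> has_real_derivative y) (at x) \<and> 0 < y"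
      using powr_primitive_has_real_derivative[of x \<alpha> UNIV] by (intro exI[of _ "x powr (- 1 - \<alpha>)"]) auto
  qed
qed

lemma powr_primitive_nonneg: "v \<ge> 1 \<Longrightarrow> powr_primitive \<alpha> v \<ge> 0"
  using powr_primitive_pos[of v \<alpha>] by (cases "v = 1") auto

lemma powr_primitive_measurable [measurable]: "powr_primitive \<alpha> \<in> borel_measurable borel"
  unfolding powr_primitive_def[abs_def] by measurable

text \<open>
  The difference quotient at \<open>\<alpha> = 0\<close> of \<open>\<alpha> \<mapsto> 1 - v powr - \<alpha>\<close>.
\<close>

lemma powr_primitive_tendsto_ln:
  assumes "v > 0" shows "((\<lambda>\<alpha>. powr_primitive \<alpha> v) \<longlongrightarrow> ln v) (at_right 0)"
proof -
  have "((\<lambda>\<alpha>. 1 - exp (- \<alpha> * ln v)) has_real_derivative ln v) (at 0)"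
    by (auto intro!: derivative_eq_intros)
  then have "((\<lambda>\<alpha>. (1 - exp (- \<alpha> * ln v)) / \<alpha>) \<longlongrightarrow> ln v) (at 0)"
    by (simp add: DERIV_def)
  then have "((\<lambda>\<alpha>. (1 - exp (- \<alpha> * ln v)) / \<alpha>) \<longlongrightarrow> ln v) (at_right 0)"
    by (rule tendsto_within_subset) auto
  moreover have "\<forall>\<^sub>F \<alpha> in at_right 0. (1 - exp (- \<alpha> * ln v)) / \<alpha> = powr_primitive \<alpha> v"
    using assms by (auto simp: eventually_at_filter powr_primitive_def powr_def intro!: always_eventually)
  ultimately show ?thesis by (rule Lim_transform_eventually)
qed

text \<open>
  This provides the integrable majorant for passing to the limit \<open>\<alpha> = 0\<close> under an integral sign.
\<close>

lemma powr_primitive_le_ln: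
  assumes "v \<ge> 1" "\<alpha> \<ge> 0" shows "powr_primitive \<alpha> v \<le> ln v"
proof (cases "\<alpha> = 0")
  case False
  have "1 + (- \<alpha> * ln v) \<le> exp (- \<alpha> * ln v)" by (rule exp_ge_add_one_self)
  then show ?thesis using False assms by (auto simp: powr_primitive_def powr_def field_simps)
qed (simp add: powr_primitive_def)

text \<open>
  The closed form of the integral of \<open>v powr (\<alpha> - 1) * powr_primitive \<alpha> v\<close> over \<open>1 \<le> v \<le> 1 / a\<close>, which is
  the common factor of the Poisson parameter and of the normalising constant of the jump density.
\<close>

definition jump_weight :: "real \<Rightarrow> real \<Rightarrow> real" where
  "jump_weight \<alpha> a = (if \<alpha> = 0 then (ln a)\<^sup>2 / 2 else (1 - a powr \<alpha> + a powr \<alpha> * ln (a powr \<alpha>)) / (\<alpha>\<^sup>2 * a powr \<alpha>))"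

lemma jump_weight_has_integral:
  assumes "0 < a" "a \<le> 1"
  shows "((\<lambda>v. v powr (\<alpha> - 1) * powr_primitive \<alpha> v) has_integral jump_weight \<alpha> a) {1..1/a}"
proof (cases "\<alpha> = 0")
  case True
  have "((\<lambda>v. v powr (\<alpha> - 1) * powr_primitive \<alpha> v) has_integral ((ln (1/a))\<^sup>2 / 2 - (ln 1)\<^sup>2 / 2)) {1..1/a}"
  proof (rule fundamental_theorem_of_calculus)
    fix v assume "v \<in> {1..1/a}"
    then show "((\<lambda>v. (ln v)\<^sup>2 / 2) has_vector_derivative v powr (\<alpha> - 1) * powr_primitive \<alpha> v) (at v within {1..1/a})"
      unfolding has_real_derivative_iff_has_vector_derivative[symmetric]
      using True by (auto intro!: derivative_eq_intros simp: powr_primitive_def powr_minus inverse_eq_divide)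
  qed (use assms in \<open>auto simp: field_simps\<close>)
  then show ?thesis using True assms by (simp add: jump_weight_def ln_div)
next
  case False
  have "((\<lambda>v. v powr (\<alpha> - 1) * powr_primitive \<alpha> v) has_integral
      (((1/a) powr \<alpha> / \<alpha>\<^sup>2 - ln (1/a) / \<alpha>) - (1 powr \<alpha> / \<alpha>\<^sup>2 - ln 1 / \<alpha>))) {1..1/a}"
  proof (rule fundamental_theorem_of_calculus)
    fix v assume v: "v \<in> {1..1/a}"
    have e: "v powr (\<alpha> - 1) * powr_primitive \<alpha> v = \<alpha> * v powr (\<alpha> - 1) / \<alpha>\<^sup>2 - 1 / v / \<alpha>"
    proof -
      have "v powr (\<alpha> - 1) * v powr - \<alpha> = v powr ((\<alpha> - 1) + - \<alpha>)" by (rule powr_add[symmetric])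
      also have "(\<alpha> - 1) + - \<alpha> = - 1" by simp
      also have "v powr - 1 = 1 / v" using v by (simp only: powr_minus) (simp add: inverse_eq_divide)
      finally have "v powr (\<alpha> - 1) * (1 - v powr - \<alpha>) = v powr (\<alpha> - 1) - 1 / v" by (simp add: algebra_simps)
      then have "v powr (\<alpha> - 1) * powr_primitive \<alpha> v = (v powr (\<alpha> - 1) - 1 / v) / \<alpha>"
        using False by (simp add: powr_primitive_def)
      also have "\<dots> = \<alpha> * v powr (\<alpha> - 1) / \<alpha>\<^sup>2 - 1 / v / \<alpha>"
        using False by (simp add: diff_divide_distrib power2_eq_square)
      finally show ?thesis .
    qed
    show "((\<lambda>v. v powr \<alpha> / \<alpha>\<^sup>2 - ln v / \<alpha>) has_vector_derivative v powr (\<alpha> - 1) * powr_primitive \<alpha> v) (at v within {1..1/a})"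
      unfolding has_real_derivative_iff_has_vector_derivative[symmetric] e
      using v by (intro DERIV_diff DERIV_cdivide DERIV_subset[OF has_real_derivative_powr]
          DERIV_subset[OF DERIV_ln_divide]) auto
  qed (use assms in \<open>auto simp: field_simps\<close>)
  moreover have "((1/a) powr \<alpha> / \<alpha>\<^sup>2 - ln (1/a) / \<alpha>) - (1 powr \<alpha> / \<alpha>\<^sup>2 - ln 1 / \<alpha>) = jump_weight \<alpha> a"
    using assms False
    by (simp add: jump_weight_def powr_divide ln_div ln_powr field_simps power2_eq_square)
  ultimately show ?thesis by simp
qed

lemma jump_weight_pos:
  assumes "0 < a" "a < 1" shows "jump_weight \<alpha> a > 0"
proof -
  have c: "continuous_on {1..1/a} (\<lambda>v. v powr (\<alpha> - 1) * powr_primitive \<alpha> v)"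
    by (intro continuous_intros powr_primitive_continuous) auto
  have i: "((\<lambda>v. v powr (\<alpha> - 1) * powr_primitive \<alpha> v) has_integral jump_weight \<alpha> a) {1..1/a}"
    using assms by (intro jump_weight_has_integral) auto
  have "jump_weight \<alpha> a \<ge> 0"
    using i by (rule has_integral_nonneg) (auto intro!: mult_nonneg_nonneg powr_primitive_nonneg)
  moreover have "jump_weight \<alpha> a \<noteq> 0"
  proof
    assume "jump_weight \<alpha> a = 0"
    with i have "((\<lambda>v. v powr (\<alpha> - 1) * powr_primitive \<alpha> v) has_integral 0) (cbox 1 (1/a))" by simp
    then have "(1/a) powr (\<alpha> - 1) * powr_primitive \<alpha> (1/a) = 0"
      by (rule has_integral_0_cbox_imp_0[rotated 2])
         (use c assms in \<open>auto simp: field_simps intro!: mult_nonneg_nonneg powr_primitive_nonneg\<close>)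
    then show False using assms powr_primitive_pos[of "1/a" \<alpha>] by (auto simp: field_simps)
  qed
  ultimately show ?thesis by simp
qed

text \<open>
  In terms of \<open>l = ln a\<close> the weight is \<open>(exp (- \<alpha> * l) - 1 + \<alpha> * l) / \<alpha>\<^sup>2\<close>, a second-order difference
  quotient of the exponential function with limit \<open>l\<^sup>2 / 2\<close>.
\<close>

lemma jump_weight_tendsto:
  assumes "0 < a"
  shows "((\<lambda>\<alpha>. jump_weight \<alpha> a) \<longlongrightarrow> jump_weight 0 a) (at_right 0)"
proof -
  define l where "l = ln a"
  have "((\<lambda>\<alpha>. (exp (- \<alpha> * l) - 1 + \<alpha> * l) / \<alpha>\<^sup>2) \<longlongrightarrow> l\<^sup>2 / 2) (at_right 0)"
  proof (rule lhopital_right_0[where f'="\<lambda>\<alpha>. - l * exp (- \<alpha> * l) + l" and g'="\<lambda>\<alpha>. 2 * \<alpha>"])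
    show "((\<lambda>\<alpha>. exp (- \<alpha> * l) - 1 + \<alpha> * l) \<longlongrightarrow> 0) (at_right 0)"
      by (auto intro!: tendsto_eq_intros)
    show "((\<lambda>\<alpha>::real. \<alpha>\<^sup>2) \<longlongrightarrow> 0) (at_right 0)" by (auto intro!: tendsto_eq_intros)
    have "((\<lambda>\<alpha>. - l * exp (- \<alpha> * l)) has_real_derivative l * l) (at 0)"
      by (auto intro!: derivative_eq_intros)
    then have "((\<lambda>\<alpha>. (- l * exp (- \<alpha> * l) - - l) / \<alpha>) \<longlongrightarrow> l * l) (at 0)"
      by (simp add: DERIV_def)
    then have "((\<lambda>\<alpha>. (- l * exp (- \<alpha> * l) - - l) / \<alpha>) \<longlongrightarrow> l * l) (at_right 0)"
      by (rule tendsto_within_subset) auto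
    then have "((\<lambda>\<alpha>. (- l * exp (- \<alpha> * l) - - l) / \<alpha> / 2) \<longlongrightarrow> l * l / 2) (at_right 0)"
      by (intro tendsto_intros) auto
    then show "((\<lambda>\<alpha>. (- l * exp (- \<alpha> * l) + l) / (2 * \<alpha>)) \<longlongrightarrow> l\<^sup>2 / 2) (at_right 0)"
      by (simp add: power2_eq_square mult.commute)
    show "\<forall>\<^sub>F \<alpha> in at_right 0. ((\<lambda>\<alpha>. exp (- \<alpha> * l) - 1 + \<alpha> * l) has_real_derivative - l * exp (- \<alpha> * l) + l) (at \<alpha>)"
      by (rule always_eventually) (auto intro!: derivative_eq_intros)
    show "\<forall>\<^sub>F \<alpha> in at_right 0. ((\<lambda>\<alpha>::real. \<alpha>\<^sup>2) has_real_derivative 2 * \<alpha>) (at \<alpha>)"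
      by (rule always_eventually) (auto intro!: derivative_eq_intros)
    show "\<forall>\<^sub>F \<alpha> in at_right 0. \<alpha>\<^sup>2 \<noteq> (0::real)" "\<forall>\<^sub>F \<alpha> in at_right 0. 2 * \<alpha> \<noteq> (0::real)"
      by (auto simp: eventually_at_filter)
  qed
  moreover have "\<forall>\<^sub>F \<alpha> in at_right 0. (exp (- \<alpha> * l) - 1 + \<alpha> * l) / \<alpha>\<^sup>2 = jump_weight \<alpha> a"
  proof (rule eventually_at_rightI)
    fix \<alpha> :: real assume "\<alpha> \<in> {0<..<1}"
    then have \<alpha>: "\<alpha> \<noteq> 0" by simp
    define E where "E = exp (\<alpha> * l)"
    have E: "E > 0" "a powr \<alpha> = E" "ln E = \<alpha> * l" "exp (- \<alpha> * l) = 1 / E"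
      using assms by (simp_all add: E_def l_def powr_def exp_minus inverse_eq_divide)
    have "jump_weight \<alpha> a = (1 - E + E * (\<alpha> * l)) / E / \<alpha>\<^sup>2"
      using \<alpha> E by (simp add: jump_weight_def mult.commute)
    also have "(1 - E + E * (\<alpha> * l)) / E = 1 / E - 1 + \<alpha> * l"
      using E(1) by (simp add: add_divide_distrib diff_divide_distrib)
    finally show "(exp (- \<alpha> * l) - 1 + \<alpha> * l) / \<alpha>\<^sup>2 = jump_weight \<alpha> a" using E by simp
  qed simp
  ultimately show ?thesis unfolding l_def
    by (simp add: jump_weight_def Lim_transform_eventually)
qed

section \<open>Splitting the Levy measure by parts\<close>

text \<open>
  The Levy density of the compound Poisson part up to the factor \<open>c * \<beta> / (T * b)\<close>, and the jump density
  up to normalisation.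
\<close>

definition jump_shape :: "real \<Rightarrow> real \<Rightarrow> real \<Rightarrow> real \<Rightarrow> real" where
  "jump_shape \<alpha> \<beta> a x = (if x > 0 then
     x powr - \<alpha> * (LINT v:{1..1/a}|lborel. exp (- \<beta> * x * v) * powr_primitive \<alpha> v) else 0)"

lemma exp_powr_primitive_continuous:
  "continuous_on {1..w} (\<lambda>v. exp (- y * v) * powr_primitive \<alpha> v)"
  by (intro continuous_intros powr_primitive_continuous) auto

text \<open>
  In the variable \<open>v = exp (b * (t - s))\<close> the left-hand side is the integral of
  \<open>exp (- y * v) * v powr (- 1 - \<alpha>)\<close> over \<open>1 \<le> v \<le> w\<close>, and the right-hand side is its integration by
  parts; the boundary term at \<open>v = 1\<close> vanishes by the choice of the primitive.
\<close>

lemma time_integral_by_parts: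
  fixes b t y \<alpha> :: real
  assumes b: "b > 0" and t: "t \<ge> 0"
  defines "w \<equiv> exp (b * t)"
  shows "b * (LINT s:{0..t}|lborel. exp (- y * exp (b * (t - s))) * exp (b * (t - s)) powr - \<alpha>) =
    exp (- y * w) * powr_primitive \<alpha> w + y * (LINT v:{1..w}|lborel. exp (- y * v) * powr_primitive \<alpha> v)"
proof -
  define V where "V = (\<lambda>s. exp (b * (t - s)))"
  \<comment> \<open>An antiderivative of \<open>exp (- y * v) * v powr (- 1 - \<alpha>)\<close>: two of the three terms of its derivative cancel.\<close>
  define P where "P = (\<lambda>v. exp (- y * v) * powr_primitive \<alpha> v + y * integral {1..v} (\<lambda>v. exp (- y * v) * powr_primitive \<alpha> v))"
  have w: "w \<ge> 1" using assms by (simp add: w_def)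
  have V_in: "V s \<in> {1..w}" if "s \<in> {0..t}" for s
    using that b unfolding V_def w_def by (auto intro!: mult_left_mono)
  have dP: "(P has_real_derivative exp (- y * v) * v powr (- 1 - \<alpha>)) (at v within {1..w})" if "v \<in> {1..w}" for v
  proof -
    have "(P has_real_derivative (exp (- y * v) * v powr (- 1 - \<alpha>) + (exp (- y * v) * (- y)) * powr_primitive \<alpha> v)
        + y * (exp (- y * v) * powr_primitive \<alpha> v)) (at v within {1..w})"
      unfolding P_def
    proof (intro DERIV_add DERIV_cmult)
      show "((\<lambda>v. integral {1..v} (\<lambda>v. exp (- y * v) * powr_primitive \<alpha> v)) has_real_derivative exp (- y * v) * powr_primitive \<alpha> v) (at v within {1..w})"
        by (rule integral_has_real_derivative[OF exp_powr_primitive_continuous that])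
      have "((\<lambda>v. exp (- y * v)) has_real_derivative exp (- y * v) * (- y)) (at v within {1..w})"
        by (auto intro!: derivative_eq_intros)
      from DERIV_mult[OF this powr_primitive_has_real_derivative[of v \<alpha> "{1..w}"]]
      show "((\<lambda>v. exp (- y * v) * powr_primitive \<alpha> v) has_real_derivative
         exp (- y * v) * v powr (- 1 - \<alpha>) + exp (- y * v) * (- y) * powr_primitive \<alpha> v) (at v within {1..w})"
        using that by (simp add: algebra_simps)
    qed
    then show ?thesis by simp
  qed
  have dV: "(V has_real_derivative - b * V s) (at s within {0..t})" for s
    unfolding V_def by (auto intro!: derivative_eq_intros)
  define g where "g = (\<lambda>s. exp (- y * V s) * V s powr - \<alpha>)"
  have "((\<lambda>s. b * g s) has_integral (- P (V t) - - P (V 0))) {0..t}"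
  proof (rule fundamental_theorem_of_calculus)
    fix s assume s: "s \<in> {0..t}"
    have "(P has_real_derivative exp (- y * V s) * V s powr (- 1 - \<alpha>)) (at (V s) within V ` {0..t})"
      by (rule DERIV_subset[OF dP[OF V_in[OF s]]]) (use V_in in blast)
    then have "((P \<circ> V) has_real_derivative exp (- y * V s) * V s powr (- 1 - \<alpha>) * (- b * V s)) (at s within {0..t})"
      by (rule DERIV_image_chain[OF _ dV])
    then have "((\<lambda>s. - (P \<circ> V) s) has_real_derivative - (exp (- y * V s) * V s powr (- 1 - \<alpha>) * (- b * V s))) (at s within {0..t})"
      by (rule DERIV_minus)
    moreover have "- (exp (- y * V s) * V s powr (- 1 - \<alpha>) * (- b * V s)) = b * g s"
    proof -
      have "V s > 0" by (simp add: V_def)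
      then have "V s powr (- 1 - \<alpha>) * V s = V s powr ((- 1 - \<alpha>) + 1)" by (simp only: powr_add powr_one)
      then have "V s powr (- 1 - \<alpha>) * V s = V s powr - \<alpha>" by simp
      then show ?thesis unfolding g_def by (simp add: mult_ac)
    qed
    ultimately have "((\<lambda>s. - (P \<circ> V) s) has_real_derivative b * g s) (at s within {0..t})"
      by (simp only:)
    then show "((\<lambda>s. - P (V s)) has_vector_derivative b * g s) (at s within {0..t})"
      by (simp add: has_real_derivative_iff_has_vector_derivative comp_def)
  qed (rule t)
  moreover have "V t = 1" "V 0 = w" by (simp_all add: V_def w_def)
  moreover have "P 1 = 0" by (simp add: P_def)
  ultimately have hi: "((\<lambda>s. b * g s) has_integral P w) {0..t}" by simp
  have V_cont: "continuous_on {0..t} V" unfolding V_def by (intro continuous_intros)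
  have "continuous_on {0..t} g"
    unfolding g_def by (intro continuous_intros V_cont) (auto simp: V_def)
  then have "continuous_on {0..t} (\<lambda>s. b * g s)" by (intro continuous_intros)
  then have "(LINT s:{0..t}|lborel. b * g s) = integral {0..t} (\<lambda>s. b * g s)"
    by (intro set_borel_integral_eq_integral borel_integrable_atLeastAtMost')
  also have "\<dots> = P w" using hi by (rule integral_unique)
  also have "P w = exp (- y * w) * powr_primitive \<alpha> w + y * (LINT v:{1..w}|lborel. exp (- y * v) * powr_primitive \<alpha> v)"
    unfolding P_def
    by (subst set_borel_integral_eq_integral(2)[OF borel_integrable_atLeastAtMost'[OF exp_powr_primitive_continuous]]) simp
  finally show ?thesis by (simp add: g_def V_def)
qed

lemma jump_shape_nn_integral:
  assumes "x > 0"
  shows "ennreal (jump_shape \<alpha> \<beta> a x) =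
    (\<integral>\<^sup>+v. ennreal (indicator {1..1/a} v * (x powr - \<alpha> * (exp (- \<beta> * x * v) * powr_primitive \<alpha> v))) \<partial>lborel)"
proof -
  have "set_integrable lborel {1..1/a} (\<lambda>v. x powr - \<alpha> * (exp (- (\<beta> * x) * v) * powr_primitive \<alpha> v))"
    by (intro borel_integrable_atLeastAtMost' continuous_on_mult continuous_on_const exp_powr_primitive_continuous)
  then have "(\<integral>\<^sup>+v. ennreal (indicator {1..1/a} v * (x powr - \<alpha> * (exp (- (\<beta> * x) * v) * powr_primitive \<alpha> v))) \<partial>lborel) =
     ennreal (LINT v:{1..1/a}|lborel. x powr - \<alpha> * (exp (- (\<beta> * x) * v) * powr_primitive \<alpha> v))"
    unfolding set_integrable_def set_lebesgue_integral_def real_scaleR_def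
    by (intro nn_integral_eq_integral) (auto simp: indicator_def intro!: mult_nonneg_nonneg powr_primitive_nonneg)
  then show ?thesis using assms by (simp add: jump_shape_def)
qed

lemma jump_shape_nonneg: "jump_shape \<alpha> \<beta> a x \<ge> 0"
proof -
  have "(LINT v:{1..1/a}|lborel. exp (- \<beta> * x * v) * powr_primitive \<alpha> v) \<ge> 0"
    unfolding set_lebesgue_integral_def
    by (intro integral_nonneg_AE AE_I2) (auto simp: indicator_def intro!: mult_nonneg_nonneg powr_primitive_nonneg)
  then show ?thesis by (simp add: jump_shape_def)
qed

lemma jump_shape_measurable [measurable]: "jump_shape \<alpha> \<beta> a \<in> borel_measurable borel"
proof -
  have "(\<lambda>x. LINT v:{1..1/a}|lborel. exp (- \<beta> * x * v) * powr_primitive \<alpha> v) \<in> borel_measurable borel"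
    unfolding set_lebesgue_integral_def
    by (rule lborel.borel_measurable_lebesgue_integral) measurable
  then show ?thesis unfolding jump_shape_def[abs_def] by measurable
qed

text \<open>
  By Tonelli: for fixed \<open>v\<close> the integral over \<open>x\<close> is a Gamma integral with rate \<open>\<beta> * v\<close>, and integrating
  the resulting power of \<open>v\<close> against the primitive gives \<open>jump_weight\<close>.
\<close>

lemma jump_shape_total_mass:
  assumes \<alpha>: "\<alpha> < 1" and \<beta>: "\<beta> > 0" and a: "0 < a" "a < 1"
  shows "(\<integral>\<^sup>+x. ennreal (jump_shape \<alpha> \<beta> a x) \<partial>lborel) =
    ennreal (Gamma (1 - \<alpha>) * \<beta> powr (\<alpha> - 1) * jump_weight \<alpha> a)"
proof -
  define k where "k = (\<lambda>x v. ennreal (indicator {1..1/a} v * powr_primitive \<alpha> v) *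
      ennreal (indicator {0<..} x * (x powr - \<alpha> * exp (- (\<beta> * v) * x))))"
  have G: "indicator {1..1/a} v * powr_primitive \<alpha> v \<ge> 0" for v
    by (auto simp: indicator_def intro!: powr_primitive_nonneg)
  have "(\<integral>\<^sup>+x. ennreal (jump_shape \<alpha> \<beta> a x) \<partial>lborel) = (\<integral>\<^sup>+x. \<integral>\<^sup>+v. k x v \<partial>lborel \<partial>lborel)"
  proof (intro nn_integral_cong)
    fix x :: real
    show "ennreal (jump_shape \<alpha> \<beta> a x) = (\<integral>\<^sup>+v. k x v \<partial>lborel)"
    proof (cases "x > 0")
      case True
      show ?thesis
        unfolding jump_shape_nn_integral[OF True] k_def
        by (intro nn_integral_cong) (use True G in \<open>auto simp: ennreal_mult'[symmetric] mult_ac\<close>)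
    qed (simp add: jump_shape_def k_def)
  qed
  also have "\<dots> = (\<integral>\<^sup>+v. \<integral>\<^sup>+x. k x v \<partial>lborel \<partial>lborel)"
    by (rule lborel_pair.Fubini'[symmetric]) (simp add: k_def)
  also have "\<dots> = (\<integral>\<^sup>+v. ennreal (Gamma (1 - \<alpha>) * \<beta> powr (\<alpha> - 1)) *
      ennreal (indicator {1..1/a} v * (v powr (\<alpha> - 1) * powr_primitive \<alpha> v)) \<partial>lborel)"
  proof (intro nn_integral_cong)
    fix v :: real
    show "(\<integral>\<^sup>+x. k x v \<partial>lborel) = ennreal (Gamma (1 - \<alpha>) * \<beta> powr (\<alpha> - 1)) *
      ennreal (indicator {1..1/a} v * (v powr (\<alpha> - 1) * powr_primitive \<alpha> v))"
    proof (cases "v \<in> {1..1/a}")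
      case True
      then have "\<beta> * v > 0" using \<beta> by simp
      have "(\<integral>\<^sup>+x. k x v \<partial>lborel) = ennreal (powr_primitive \<alpha> v) * ennreal (Gamma (1 - \<alpha>) * (\<beta> * v) powr (\<alpha> - 1))"
        unfolding k_def using True
        by (subst nn_integral_cmult) (simp_all only: nn_integral_powr_exp[OF \<alpha> \<open>\<beta> * v > 0\<close>], auto)
      then show ?thesis using True \<alpha> \<beta> powr_primitive_nonneg[of v \<alpha>]
        by (simp add: ennreal_mult'[symmetric] ennreal_mult''[symmetric] powr_mult Gamma_real_nonneg mult_ac)
    qed (simp add: k_def)
  qed
  also have "\<dots> = ennreal (Gamma (1 - \<alpha>) * \<beta> powr (\<alpha> - 1)) * ennreal (jump_weight \<alpha> a)"
    by (subst nn_integral_cmult, simp)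
       (subst nn_integral_has_integral_lebesgue[OF _ jump_weight_has_integral],
        use a in \<open>auto intro!: mult_nonneg_nonneg powr_primitive_nonneg\<close>)
  also have "\<dots> = ennreal (Gamma (1 - \<alpha>) * \<beta> powr (\<alpha> - 1) * jump_weight \<alpha> a)"
    using \<alpha> \<beta> by (intro ennreal_mult'[symmetric] mult_nonneg_nonneg Gamma_real_nonneg) auto
  finally show ?thesis .
qed

text \<open>
  By dilation the exponent at time \<open>s\<close> has the Levy density \<open>k s\<close> below. Fubini moves the time integral
  inside, where \<open>time_integral_by_parts\<close> with \<open>y = \<beta> * x\<close> splits the density into a tempered stable
  one and one of finite mass. Fubini applies since \<open>k s\<close> is bounded by \<open>k t\<close>, the original density,
  and \<open>iexp (u * x) - 1\<close> by \<open>\<bar>u * x\<bar>\<close>.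
\<close>

lemma time_integral_of_exponent:
  assumes b: "b > 0" and t: "t > 0" and \<alpha>: "0 \<le> \<alpha>" "\<alpha> < 1" and \<beta>: "\<beta> > 0" and c: "c > 0"
    and a: "a = exp (- b * t)"
  shows "complex_of_real b * (CLINT s:{0..t}|lborel. levy_exponent (cts_levy_density \<alpha> \<beta> c) (u * exp (- b * (t - s)))) =
     levy_exponent (cts_levy_density \<alpha> (\<beta> / a) (c * powr_primitive \<alpha> (1 / a))) u +
     levy_exponent (\<lambda>x. c * \<beta> * jump_shape \<alpha> \<beta> a x) u"
proof -
  have a01: "0 < a" "a < 1" using a b t by auto
  have w: "exp (b * t) = 1 / a" by (simp add: a exp_minus inverse_eq_divide)
  define V where "V = (\<lambda>s. exp (b * (t - s)))"
  have V_ge: "V s \<ge> 1" if "s \<le> t" for s using that b by (simp add: V_def)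
  have V_pos: "V s > 0" for s by (simp add: V_def)
  define k where "k = (\<lambda>s x. cts_levy_density \<alpha> (\<beta> * V s) (c * V s powr - \<alpha>) x)"
  have V_meas[measurable]: "V \<in> borel_measurable borel" unfolding V_def by measurable
  have k_meas[measurable]: "(\<lambda>(s, x). k s x) \<in> borel_measurable (lborel \<Otimes>\<^sub>M lborel)"
    unfolding k_def cts_levy_density_def by measurable
  have k_bounds: "0 \<le> k s x \<and> k s x \<le> cts_levy_density \<alpha> \<beta> c x" if "s \<le> t" for s x
  proof (cases "x > 0")
    case True
    have "V s powr - \<alpha> \<le> 1" using V_ge[OF that] \<alpha> by (simp add: powr_minus ge_one_powr_ge_zero inverse_le_1_iff)
    moreover have "exp (- (\<beta> * V s) * x) \<le> exp (- \<beta> * x)"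
      using V_ge[OF that] \<beta> True by (simp add: mult_le_cancel_left1)
    ultimately have "V s powr - \<alpha> * exp (- (\<beta> * V s) * x) \<le> 1 * exp (- \<beta> * x)"
      by (intro mult_mono) auto
    then have "c * (V s powr - \<alpha> * exp (- (\<beta> * V s) * x)) / x powr (1 + \<alpha>) \<le> c * exp (- \<beta> * x) / x powr (1 + \<alpha>)"
      using c by (intro divide_right_mono mult_left_mono) auto
    then show ?thesis using True c by (simp add: k_def cts_levy_density_def mult.assoc)
  qed (simp add: k_def cts_levy_density_def)
  define H where "H = (\<lambda>s x. indicator {0..t} s *\<^sub>R ((iexp (u * x) - 1) * complex_of_real (k s x)))"
  have H_meas[measurable]: "case_prod H \<in> borel_measurable (lborel \<Otimes>\<^sub>M lborel)"
    unfolding H_def split_def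
    using k_meas by (auto simp: split_def)
  define B where "B = (\<lambda>p. indicator {0..t} (fst p) * (\<bar>u\<bar> * (\<bar>snd p\<bar> * \<bar>cts_levy_density \<alpha> \<beta> c (snd p)\<bar>)) :: real)"
  have mom: "integrable lborel (\<lambda>x. \<bar>x\<bar> * \<bar>cts_levy_density \<alpha> \<beta> c x\<bar>)"
    by (rule cts_levy_density_first_moment[OF \<alpha>(2) \<beta>])
  have B_int: "integrable (lborel \<Otimes>\<^sub>M lborel) B"
  proof (rule lborel_pair.Fubini_integrable)
    show "B \<in> borel_measurable (lborel \<Otimes>\<^sub>M lborel)" unfolding B_def by measurable
    show "AE s in lborel. integrable lborel (\<lambda>x. B (s, x))"
      using mom by (intro AE_I2) (simp add: B_def)
    have "(\<lambda>s. LINT x|lborel. norm (B (s, x))) = (\<lambda>s. indicator {0..t} s * (LINT x|lborel. \<bar>u\<bar> * (\<bar>x\<bar> * \<bar>cts_levy_density \<alpha> \<beta> c x\<bar>)))"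
      by (rule ext) (simp add: B_def abs_mult indicator_def)
    moreover have "integrable lborel (\<lambda>s. indicator {0..t} s * (LINT x|lborel. \<bar>u\<bar> * (\<bar>x\<bar> * \<bar>cts_levy_density \<alpha> \<beta> c x\<bar>)))"
      by (intro integrable_mult_left integrable_real_indicator) (auto simp: emeasure_lborel_Icc_eq)
    ultimately show "integrable lborel (\<lambda>s. LINT x|lborel. norm (B (s, x)))" by simp
  qed
  have H_int: "integrable (lborel \<Otimes>\<^sub>M lborel) (case_prod H)"
  proof (rule Bochner_Integration.integrable_bound[OF B_int H_meas], rule AE_I2)
    fix p :: "real \<times> real"
    obtain s x where p: "p = (s, x)" by fastforce
    show "norm (case_prod H p) \<le> norm (B p)"
    proof (cases "s \<in> {0..t}")
      case True
      have "norm (iexp (u * x) - 1) \<le> \<bar>u * x\<bar>" using norm_iexp_diff_le[of "u * x" 0] by simp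
      then have "norm (iexp (u * x) - 1) * \<bar>k s x\<bar> \<le> \<bar>u * x\<bar> * \<bar>cts_levy_density \<alpha> \<beta> c x\<bar>"
        using k_bounds[of s x] True by (intro mult_mono) auto
      then show ?thesis using True by (simp add: p H_def B_def norm_mult abs_mult mult.assoc)
    qed (simp add: p H_def B_def)
  qed
  have inner_s: "(LINT s:{0..t}|lborel. k s x) =
     (cts_levy_density \<alpha> (\<beta> / a) (c * powr_primitive \<alpha> (1 / a)) x + c * \<beta> * jump_shape \<alpha> \<beta> a x) / b" for x
  proof (cases "x > 0")
    case True
    define J where "J = (LINT v:{1..1/a}|lborel. exp (- \<beta> * x * v) * powr_primitive \<alpha> v)"
    have k_eq: "k s x = c / x powr (1 + \<alpha>) * (exp (- (\<beta> * x) * V s) * V s powr - \<alpha>)" for s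
      using True by (simp add: k_def cts_levy_density_def mult_ac)
    have "(LINT s:{0..t}|lborel. k s x) = c / x powr (1 + \<alpha>) * (LINT s:{0..t}|lborel. exp (- (\<beta> * x) * V s) * V s powr - \<alpha>)"
      unfolding k_eq by (rule set_integral_mult_right)
    also have "(LINT s:{0..t}|lborel. exp (- (\<beta> * x) * V s) * V s powr - \<alpha>) =
       (exp (- (\<beta> * x) * (1 / a)) * powr_primitive \<alpha> (1 / a) + \<beta> * x * J) / b"
      using time_integral_by_parts[OF b less_imp_le[OF t], of "\<beta> * x" \<alpha>] b
      unfolding w V_def J_def by (simp add: field_simps)
    also have "c / x powr (1 + \<alpha>) * ((exp (- (\<beta> * x) * (1 / a)) * powr_primitive \<alpha> (1 / a) + \<beta> * x * J) / b) =
      (c * powr_primitive \<alpha> (1 / a) * exp (- (\<beta> / a) * x) / x powr (1 + \<alpha>) + c * \<beta> * (x / x powr (1 + \<alpha>) * J)) / b"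
      by (simp add: add_divide_distrib distrib_left mult_ac)
    also have "x / x powr (1 + \<alpha>) = x powr - \<alpha>"
      using True by (simp add: powr_add powr_minus inverse_eq_divide)
    finally show ?thesis using True by (simp add: cts_levy_density_def jump_shape_def J_def)
  qed (simp add: k_def cts_levy_density_def jump_shape_def)
  define \<nu>1 where "\<nu>1 = cts_levy_density \<alpha> (\<beta> / a) (c * powr_primitive \<alpha> (1 / a))"
  define \<nu>2 where "\<nu>2 = (\<lambda>x. c * \<beta> * jump_shape \<alpha> \<beta> a x)"
  have i1: "integrable lborel (\<lambda>x. (iexp (u * x) - 1) * complex_of_real (\<nu>1 x))"
    unfolding \<nu>1_def using \<alpha> \<beta> a01 by (intro levy_exponent_integrable cts_levy_density_first_moment) auto
  have i2: "integrable lborel (\<lambda>x. (iexp (u * x) - 1) * complex_of_real (\<nu>2 x))"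
  proof (rule Bochner_Integration.integrable_bound)
    have "integrable lborel (jump_shape \<alpha> \<beta> a)"
      by (rule integrableI_nonneg)
         (auto simp: jump_shape_nonneg jump_shape_total_mass[OF \<alpha>(2) \<beta> a01])
    then show "integrable lborel (\<lambda>x. 2 * (c * \<beta> * jump_shape \<alpha> \<beta> a x))" by simp
    show "(\<lambda>x. (iexp (u * x) - 1) * complex_of_real (\<nu>2 x)) \<in> borel_measurable lborel"
      unfolding \<nu>2_def by measurable
    show "AE x in lborel. norm ((iexp (u * x) - 1) * complex_of_real (\<nu>2 x)) \<le> norm (2 * (c * \<beta> * jump_shape \<alpha> \<beta> a x))"
    proof (rule AE_I2)
      fix x :: real
      have "norm (iexp (u * x) - 1) \<le> norm (iexp (u * x)) + norm (1::complex)" by (rule norm_triangle_ineq4)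
      then have "norm (iexp (u * x) - 1) \<le> 2" by simp
      then have "norm (iexp (u * x) - 1) * \<bar>\<nu>2 x\<bar> \<le> 2 * \<bar>\<nu>2 x\<bar>" by (intro mult_right_mono) auto
      then show "norm ((iexp (u * x) - 1) * complex_of_real (\<nu>2 x)) \<le> norm (2 * (c * \<beta> * jump_shape \<alpha> \<beta> a x))"
        by (simp add: norm_mult \<nu>2_def abs_mult)
    qed
  qed
  have "(CLINT s:{0..t}|lborel. levy_exponent (cts_levy_density \<alpha> \<beta> c) (u * exp (- b * (t - s)))) =
      (\<integral>s. \<integral>x. H s x \<partial>lborel \<partial>lborel)"
    unfolding set_lebesgue_integral_def
  proof (intro Bochner_Integration.integral_cong refl)
    fix s :: real
    have "levy_exponent (cts_levy_density \<alpha> \<beta> c) (u * exp (- b * (t - s))) = levy_exponent (k s) u"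
    proof -
      have e: "exp (- b * (t - s)) = 1 / V s" by (simp add: V_def exp_minus inverse_eq_divide)
      have "levy_exponent (cts_levy_density \<alpha> \<beta> c) ((1 / V s) * u) =
         levy_exponent (cts_levy_density \<alpha> (\<beta> / (1 / V s)) (c * (1 / V s) powr \<alpha>)) u"
        using V_pos by (intro cts_exponent_dilation) simp
      then show ?thesis
        unfolding e k_def using V_pos[of s] by (simp add: powr_divide powr_minus inverse_eq_divide mult.commute)
    qed
    then show "indicator {0..t} s *\<^sub>R levy_exponent (cts_levy_density \<alpha> \<beta> c) (u * exp (- b * (t - s))) = (\<integral>x. H s x \<partial>lborel)"
      by (simp add: H_def levy_exponent_def)
  qed
  also have "\<dots> = (\<integral>x. \<integral>s. H s x \<partial>lborel \<partial>lborel)"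
    by (rule lborel_pair.Fubini_integral[OF H_int, symmetric])
  also have "\<dots> = (\<integral>x. ((iexp (u * x) - 1) * complex_of_real (\<nu>1 x) + (iexp (u * x) - 1) * complex_of_real (\<nu>2 x)) / complex_of_real b \<partial>lborel)"
  proof (intro Bochner_Integration.integral_cong refl)
    fix x :: real
    have "(\<integral>s. H s x \<partial>lborel) = (\<integral>s. (iexp (u * x) - 1) * complex_of_real (indicator {0..t} s * k s x) \<partial>lborel)"
      by (intro Bochner_Integration.integral_cong) (auto simp: H_def indicator_def)
    also have "\<dots> = (iexp (u * x) - 1) * complex_of_real (LINT s:{0..t}|lborel. k s x)"
      unfolding set_lebesgue_integral_def by (simp only: integral_mult_right_zero integral_complex_of_real real_scaleR_def)
    finally show "(\<integral>s. H s x \<partial>lborel) = ((iexp (u * x) - 1) * complex_of_real (\<nu>1 x) + (iexp (u * x) - 1) * complex_of_real (\<nu>2 x)) / complex_of_real b"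
      unfolding inner_s \<nu>1_def \<nu>2_def by (simp only: of_real_divide of_real_add distrib_left times_divide_eq_right)
  qed
  also have "\<dots> = (levy_exponent \<nu>1 u + levy_exponent \<nu>2 u) / complex_of_real b"
    unfolding levy_exponent_def using i1 i2 by simp
  finally show ?thesis using b unfolding \<nu>1_def \<nu>2_def by simp
qed

section \<open>The parameters, including their limits at zero\<close>

lemma ext_at_0_eq:
  assumes "\<And>\<alpha>. \<alpha> \<noteq> 0 \<Longrightarrow> g \<alpha> = F \<alpha>" and "(F \<longlongrightarrow> F 0) (at_right 0)"
  shows "ext_at_0 g \<alpha> = F \<alpha>"
proof (cases "\<alpha> = 0")
  case True
  have "\<forall>\<^sub>F \<alpha> in at_right 0. F \<alpha> = g \<alpha>"
    using assms(1) by (intro eventually_at_rightI[of 0 1]) auto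
  with assms(2) have "(g \<longlongrightarrow> F 0) (at_right 0)" by (rule Lim_transform_eventually)
  then have "Lim (at_right 0) g = F 0" by (intro tendsto_Lim) auto
  then show ?thesis using True by (simp add: ext_at_0_def)
qed (simp add: ext_at_0_def assms(1))

lemma OU_CTS_factor_eq:
  assumes "0 < a"
  shows "OU_CTS_factor a \<alpha> = powr_primitive \<alpha> (1 / a)"
  unfolding OU_CTS_factor_def
proof (rule ext_at_0_eq)
  show "(1 - a powr \<alpha>) / \<alpha> = powr_primitive \<alpha> (1 / a)" if "\<alpha> \<noteq> 0" for \<alpha>
    using assms that by (simp add: powr_primitive_def powr_divide powr_minus)
  show "((\<lambda>\<alpha>. powr_primitive \<alpha> (1 / a)) \<longlongrightarrow> powr_primitive 0 (1 / a)) (at_right 0)"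
    using powr_primitive_tendsto_ln[of "1 / a"] assms by (simp add: powr_primitive_def[of 0])
qed

lemma Gamma_one_minus_tendsto: "((\<lambda>\<alpha>::real. Gamma (1 - \<alpha>)) \<longlongrightarrow> Gamma (1 - 0)) (at_right 0)"
proof (rule tendsto_Gamma)
  show "((\<lambda>\<alpha>::real. 1 - \<alpha>) \<longlongrightarrow> 1 - 0) (at_right 0)" by (intro tendsto_intros)
qed simp

lemma OU_CTS_rate_eq:
  assumes "0 < a" "\<beta> > 0"
  shows "OU_CTS_rate T b \<beta> c a \<alpha> = c * \<beta> powr \<alpha> * Gamma (1 - \<alpha>) / (T * b) * jump_weight \<alpha> a"
  unfolding OU_CTS_rate_def
proof (rule ext_at_0_eq)
  let ?g = "\<lambda>\<alpha>. c * \<beta> powr \<alpha> * Gamma (1 - \<alpha>) / (T * b * \<alpha>\<^sup>2 * a powr \<alpha>) * (1 - a powr \<alpha> + a powr \<alpha> * ln (a powr \<alpha>))"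
  let ?F = "\<lambda>\<alpha>. c * \<beta> powr \<alpha> * Gamma (1 - \<alpha>) / (T * b) * jump_weight \<alpha> a"
  show "?g \<alpha> = ?F \<alpha>" if "\<alpha> \<noteq> 0" for \<alpha>
    unfolding jump_weight_def using that by (simp only: if_False times_divide_times_eq mult.assoc) simp
  have p: "((\<lambda>\<alpha>. \<beta> powr \<alpha>) \<longlongrightarrow> \<beta> powr 0) (at_right 0)" using assms by (intro tendsto_intros) auto
  show "(?F \<longlongrightarrow> ?F 0) (at_right 0)"
    unfolding divide_inverse
    by (intro tendsto_mult tendsto_const p Gamma_one_minus_tendsto jump_weight_tendsto assms)
qed

lemma jump_shape_tendsto:
  assumes "x > 0" "0 < a"
  shows "((\<lambda>\<alpha>. jump_shape \<alpha> \<beta> a x) \<longlongrightarrow> jump_shape 0 \<beta> a x) (at_right 0)"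
proof -
  have "((\<lambda>\<alpha>. LINT v:{1..1/a}|lborel. exp (- \<beta> * x * v) * powr_primitive \<alpha> v) \<longlongrightarrow>
     (LINT v:{1..1/a}|lborel. exp (- \<beta> * x * v) * powr_primitive 0 v)) (at_right 0)"
    unfolding tendsto_at_iff_sequentially comp_def
  proof (intro allI impI)
    fix X :: "nat \<Rightarrow> real" assume X: "\<forall>i. X i \<in> {0<..} - {0}" "X \<longlonglongrightarrow> 0"
    have X_pos: "X n > 0" for n using X(1)[rule_format, of n] by simp
    have X0: "filterlim X (at_right 0) sequentially"
      unfolding filterlim_at
      by (intro conjI X(2) always_eventually allI) (use X_pos in \<open>simp_all add: less_imp_neq[symmetric]\<close>)
    show "(\<lambda>n. LINT v:{1..1/a}|lborel. exp (- \<beta> * x * v) * powr_primitive (X n) v) \<longlonglongrightarrow>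
       (LINT v:{1..1/a}|lborel. exp (- \<beta> * x * v) * powr_primitive 0 v)"
      unfolding set_lebesgue_integral_def
    proof (rule integral_dominated_convergence[where w="\<lambda>v. indicator {1..1/a} v *\<^sub>R (exp (- \<beta> * x * v) * ln v)"])
      have "set_integrable lborel {1..1/a} (\<lambda>v. exp (- \<beta> * x * v) * ln v)"
        by (intro borel_integrable_atLeastAtMost' continuous_intros) auto
      then show "integrable lborel (\<lambda>v. indicator {1..1/a} v *\<^sub>R (exp (- \<beta> * x * v) * ln v))"
        by (simp add: set_integrable_def)
      show "AE v in lborel. (\<lambda>n. indicator {1..1/a} v *\<^sub>R (exp (- \<beta> * x * v) * powr_primitive (X n) v))
          \<longlonglongrightarrow> indicator {1..1/a} v *\<^sub>R (exp (- \<beta> * x * v) * powr_primitive 0 v)"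
      proof (rule AE_I2)
        fix v :: real
        show "(\<lambda>n. indicator {1..1/a} v *\<^sub>R (exp (- \<beta> * x * v) * powr_primitive (X n) v))
          \<longlonglongrightarrow> indicator {1..1/a} v *\<^sub>R (exp (- \<beta> * x * v) * powr_primitive 0 v)"
        proof (cases "v \<in> {1..1/a}")
          case True
          then have "(\<lambda>n. powr_primitive (X n) v) \<longlonglongrightarrow> ln v"
            by (intro filterlim_compose[OF powr_primitive_tendsto_ln X0]) auto
          then show ?thesis unfolding powr_primitive_def[of 0] by (auto intro!: tendsto_intros)
        qed simp
      qed
      show "AE v in lborel. norm (indicator {1..1/a} v *\<^sub>R (exp (- \<beta> * x * v) * powr_primitive (X n) v))
         \<le> indicator {1..1/a} v *\<^sub>R (exp (- \<beta> * x * v) * ln v)" for n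
      proof (rule AE_I2)
        fix v :: real
        have "X n \<ge> 0" using X_pos[of n] by simp
        then show "norm (indicator {1..1/a} v *\<^sub>R (exp (- \<beta> * x * v) * powr_primitive (X n) v))
         \<le> indicator {1..1/a} v *\<^sub>R (exp (- \<beta> * x * v) * ln v)"
          using powr_primitive_nonneg[of v "X n"] powr_primitive_le_ln[of v "X n"]
          by (auto simp: indicator_def abs_mult)
      qed
    qed measurable
  qed
  moreover have "((\<lambda>\<alpha>. x powr - \<alpha>) \<longlongrightarrow> x powr - 0) (at_right 0)"
    using assms by (intro tendsto_intros) auto
  ultimately show ?thesis unfolding jump_shape_def using assms by (simp only: if_True tendsto_mult)
qed

text \<open>
  Since \<open>v powr (1 - \<alpha>) * (v powr \<alpha> - 1) / v = \<alpha> * powr_primitive \<alpha> v\<close>, the integrand is a multiple of the one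
  in \<open>jump_shape\<close>, and the prefactor is a multiple of the inverse of \<open>jump_weight\<close>.
\<close>

lemma OU_CTS_jump_density_eq:
  assumes a: "0 < a" "a < 1" and \<beta>: "\<beta> > 0"
  shows "OU_CTS_jump_density \<beta> a \<alpha> x =
    \<beta> powr (1 - \<alpha>) / (Gamma (1 - \<alpha>) * jump_weight \<alpha> a) * jump_shape \<alpha> \<beta> a x"
proof (cases "x > 0")
  case x: True
  let ?D = "\<lambda>\<alpha>. 1 - a powr \<alpha> + a powr \<alpha> * ln (a powr \<alpha>)"
  let ?i = "\<lambda>\<alpha> v. x powr - \<alpha> * (\<beta> * v) powr (1 - \<alpha>) * exp (- \<beta> * v * x) / Gamma (1 - \<alpha>) * ((v powr \<alpha> - 1) / v)"
  let ?g = "\<lambda>\<alpha>. \<alpha> * a powr \<alpha> / ?D \<alpha> * set_lebesgue_integral lborel {1..1/a} (?i \<alpha>)"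
  let ?F = "\<lambda>\<alpha>. \<beta> powr (1 - \<alpha>) / (Gamma (1 - \<alpha>) * jump_weight \<alpha> a) * jump_shape \<alpha> \<beta> a x"
  have e: "?g \<alpha> = ?F \<alpha>" if \<alpha>: "\<alpha> \<noteq> 0" for \<alpha>
  proof -
    define C where "C = \<alpha> * x powr - \<alpha> * \<beta> powr (1 - \<alpha>) / Gamma (1 - \<alpha>)"
    have "set_lebesgue_integral lborel {1..1/a} (?i \<alpha>) =
       (LINT v:{1..1/a}|lborel. C * (exp (- \<beta> * x * v) * powr_primitive \<alpha> v))"
    proof (rule set_lebesgue_integral_cong)
      show "\<forall>v. v \<in> {1..1/a} \<longrightarrow> ?i \<alpha> v = C * (exp (- \<beta> * x * v) * powr_primitive \<alpha> v)"
      proof (intro allI impI)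
        fix v assume "v \<in> {1..1/a}"
        then have v: "v > 0" by simp
        have "v powr (1 - \<alpha>) * ((v powr \<alpha> - 1) / v) = 1 - v powr - \<alpha>"
        proof -
          have "v powr (1 - \<alpha>) = v * v powr - \<alpha>" using v by (simp add: powr_diff powr_minus divide_inverse)
          then have "v powr (1 - \<alpha>) * ((v powr \<alpha> - 1) / v) = v powr - \<alpha> * (v powr \<alpha> - 1)" using v by simp
          also have "\<dots> = v powr - \<alpha> * v powr \<alpha> - v powr - \<alpha>" by (simp only: right_diff_distrib mult_1_right)
          also have "v powr - \<alpha> * v powr \<alpha> = 1" using v by (simp add: powr_minus)
          finally show ?thesis .
        qed
        then have "v powr (1 - \<alpha>) * ((v powr \<alpha> - 1) / v) = \<alpha> * powr_primitive \<alpha> v"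
          using \<alpha> by (simp add: powr_primitive_def)
        moreover have "?i \<alpha> v = x powr - \<alpha> * \<beta> powr (1 - \<alpha>) / Gamma (1 - \<alpha>) * exp (- \<beta> * x * v) * (v powr (1 - \<alpha>) * ((v powr \<alpha> - 1) / v))"
          using \<beta> v by (simp add: powr_mult mult_ac)
        ultimately show "?i \<alpha> v = C * (exp (- \<beta> * x * v) * powr_primitive \<alpha> v)"
          by (simp only:) (simp add: C_def mult_ac)
      qed
    qed simp
    also have "\<dots> = C * (LINT v:{1..1/a}|lborel. exp (- \<beta> * x * v) * powr_primitive \<alpha> v)"
      by (rule set_integral_mult_right)
    also have "\<dots> = \<alpha> * \<beta> powr (1 - \<alpha>) / Gamma (1 - \<alpha>) * jump_shape \<alpha> \<beta> a x"
      using x by (simp add: C_def jump_shape_def)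
    finally have "?g \<alpha> = \<alpha> * a powr \<alpha> / ?D \<alpha> * (\<alpha> * \<beta> powr (1 - \<alpha>) / Gamma (1 - \<alpha>) * jump_shape \<alpha> \<beta> a x)"
      by simp
    also have "\<dots> = (\<alpha>\<^sup>2 * a powr \<alpha>) / ?D \<alpha> * (\<beta> powr (1 - \<alpha>) / Gamma (1 - \<alpha>) * jump_shape \<alpha> \<beta> a x)"
      by (simp add: power2_eq_square mult_ac)
    also have "(\<alpha>\<^sup>2 * a powr \<alpha>) / ?D \<alpha> = 1 / jump_weight \<alpha> a"
      using \<alpha> by (simp add: jump_weight_def)
    finally show ?thesis by (simp add: mult.commute)
  qed
  have "ext_at_0 ?g \<alpha> = ?F \<alpha>"
  proof (rule ext_at_0_eq)
    show "?g \<alpha> = ?F \<alpha>" if "\<alpha> \<noteq> 0" for \<alpha> using that by (rule e)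
    have p: "((\<lambda>\<alpha>. \<beta> powr (1 - \<alpha>)) \<longlongrightarrow> \<beta> powr (1 - 0)) (at_right 0)" using \<beta> by (intro tendsto_intros) auto
    show "(?F \<longlongrightarrow> ?F 0) (at_right 0)"
      by (intro tendsto_mult tendsto_divide p Gamma_one_minus_tendsto jump_weight_tendsto jump_shape_tendsto x a)
         (use jump_weight_pos[OF a, of 0] in simp)
  qed
  then show ?thesis using x by (simp add: OU_CTS_jump_density_def)
qed (simp add: OU_CTS_jump_density_def jump_shape_def)

lemma OU_CTS_jump_density_prob_space:
  assumes a: "0 < a" "a < 1" and \<beta>: "\<beta> > 0" and \<alpha>: "\<alpha> < 1"
  shows "prob_space (density lborel (\<lambda>x. ennreal (OU_CTS_jump_density \<beta> a \<alpha> x)))"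
proof (rule prob_spaceI)
  define C where "C = \<beta> powr (1 - \<alpha>) / (Gamma (1 - \<alpha>) * jump_weight \<alpha> a)"
  have pos: "Gamma (1 - \<alpha>) > 0" "jump_weight \<alpha> a > 0"
    using \<alpha> jump_weight_pos[OF a] by (auto intro: Gamma_real_pos)
  have C: "C \<ge> 0" unfolding C_def using pos by simp
  have "OU_CTS_jump_density \<beta> a \<alpha> = (\<lambda>x. C * jump_shape \<alpha> \<beta> a x)"
    unfolding C_def by (rule ext) (rule OU_CTS_jump_density_eq[OF a \<beta>])
  then have "emeasure (density lborel (\<lambda>x. ennreal (OU_CTS_jump_density \<beta> a \<alpha> x)))
      (space (density lborel (\<lambda>x. ennreal (OU_CTS_jump_density \<beta> a \<alpha> x)))) =
      (\<integral>\<^sup>+x. ennreal C * ennreal (jump_shape \<alpha> \<beta> a x) \<partial>lborel)"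
    using C by (simp add: emeasure_density ennreal_mult jump_shape_nonneg)
  also have "\<dots> = ennreal C * ennreal (Gamma (1 - \<alpha>) * \<beta> powr (\<alpha> - 1) * jump_weight \<alpha> a)"
    by (subst nn_integral_cmult) (simp_all add: jump_shape_total_mass[OF \<alpha> \<beta> a])
  also have "\<dots> = ennreal (C * (Gamma (1 - \<alpha>) * \<beta> powr (\<alpha> - 1) * jump_weight \<alpha> a))"
    using C by (simp add: ennreal_mult')
  also have "C * (Gamma (1 - \<alpha>) * \<beta> powr (\<alpha> - 1) * jump_weight \<alpha> a) = \<beta> powr (1 - \<alpha>) * \<beta> powr (\<alpha> - 1)"
    unfolding C_def using pos by simp
  also have "\<dots> = 1" using \<beta> by (simp add: powr_add[symmetric])
  finally show "emeasure (density lborel (\<lambda>x. ennreal (OU_CTS_jump_density \<beta> a \<alpha> x)))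
      (space (density lborel (\<lambda>x. ennreal (OU_CTS_jump_density \<beta> a \<alpha> x)))) = 1" by simp
qed

section \<open>The decomposition\<close>

theorem proposition5p1:
  fixes M :: "'a measure"
    and L X :: "real \<Rightarrow> 'a \<Rightarrow> real"
    and X0 :: "'a \<Rightarrow> real"
    and b T \<alpha> \<beta> c t a :: real
  assumes "b > 0" and "T > 0" and "0 \<le> \<alpha>" and "\<alpha> < 1" and "\<beta> > 0" and "c > 0"
    and "prob_space M"
    and "levy_process M L"
    and "cts_law \<alpha> \<beta> c (distr M borel (L T))"
    and "X0 \<in> borel_measurable M"
    and "indep_rv M borel X0
           (Pi\<^sub>M {0..} (\<lambda>_. borel)) (\<lambda>\<omega>. \<lambda>s\<in>{0..}. L s \<omega>)"
    and "OU_solution M b X0 L X"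
    and "t > 0"
    and "a = exp (- b * t)"
  shows "\<exists>(P :: (nat \<Rightarrow> real) measure) X0' X1 X2 N J.
           prob_space P
         \<and> prob_space.indep_vars P (\<lambda>_. borel) (\<lambda>i. [X0', X1, X2] ! i) {..<3}
         \<and> distr P borel X0' = distr M borel X0
         \<and> cts_law \<alpha> (\<beta> / a) (c * OU_CTS_factor a \<alpha> / (T * b)) (distr P borel X1)
         \<and> compound_poisson P (OU_CTS_rate T b \<beta> c a \<alpha>) (OU_CTS_jump_density \<beta> a \<alpha>) N J X2
         \<and> distr M borel (X t) = distr P borel (\<lambda>\<omega>. a * X0' \<omega> + X1 \<omega> + X2 \<omega>)"
proof -
  note b = assms(1) and T = assms(2) and \<alpha> = assms(3,4) and \<beta> = assms(5) and c = assms(6)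
    and L = assms(8) and t = assms(13) and a_def = assms(14)
  note X0[measurable] = assms(10)
  interpret M: prob_space M by fact
  have a: "0 < a" "a < 1" using a_def b t by auto
  have L_meas: "L s \<in> borel_measurable M" if "s \<ge> 0" for s
    using L that by (simp add: levy_process_def)
  define \<psi> where "\<psi> = levy_exponent (cts_levy_density \<alpha> \<beta> c)"
  have \<psi>_cont: "continuous_on UNIV \<psi>"
    unfolding \<psi>_def by (intro levy_exponent_continuous cts_levy_density_measurable cts_levy_density_first_moment \<alpha> \<beta>)
  have char_L: "char (distr M borel (L s)) u = exp (complex_of_real (s / T) * \<psi> u)" if "s \<ge> 0" for s u
  proof (rule levy_process_char[OF L T that \<psi>_cont])
    show "\<psi> 0 = 0" by (simp add: \<psi>_def)
    show "char (distr M borel (L T)) u = exp (\<psi> u)" for u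
      using assms(9) by (simp add: cts_law_def \<psi>_def levy_exponent_def)
  qed
  have law: "cts_law \<alpha> (\<beta> / \<kappa>) (s / T * c * \<kappa> powr \<alpha>) (distr M borel (\<lambda>\<omega>. \<kappa> * L s \<omega>))" if "s > 0" "\<kappa> > 0" for s \<kappa>
  proof -
    have m: "L s \<in> borel_measurable M" using that by (intro L_meas) simp
    have "char (distr M borel (\<lambda>\<omega>. \<kappa> * L s \<omega>)) u =
        exp (levy_exponent (cts_levy_density \<alpha> (\<beta> / \<kappa>) (s / T * c * \<kappa> powr \<alpha>)) u)" for u
    proof -
      have "complex_of_real (s / T) * \<psi> (\<kappa> * u) =
          levy_exponent (\<lambda>x. s / T * cts_levy_density \<alpha> (\<beta> / \<kappa>) (c * \<kappa> powr \<alpha>) x) u"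
        unfolding \<psi>_def levy_exponent_scale cts_exponent_dilation[OF that(2)] ..
      also have "(\<lambda>x. s / T * cts_levy_density \<alpha> (\<beta> / \<kappa>) (c * \<kappa> powr \<alpha>) x) =
          cts_levy_density \<alpha> (\<beta> / \<kappa>) (s / T * c * \<kappa> powr \<alpha>)"
        by (simp only: cts_levy_density_scale[symmetric] mult.assoc)
      finally show ?thesis
        unfolding char_distr_scale[OF m] char_L[OF less_imp_le[OF that(1)]] by simp
    qed
    moreover have "real_distribution (distr M borel (\<lambda>\<omega>. \<kappa> * L s \<omega>))" using m by auto
    ultimately show ?thesis
      using that T \<alpha> \<beta> c unfolding cts_law_def levy_exponent_def by auto
  qed
  have paths: "AE \<omega> in M. \<forall>s t. 0 \<le> s \<longrightarrow> s \<le> t \<longrightarrow> L s \<omega> \<le> L t \<omega>"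
  proof (rule levy_process_nondecreasing_paths[OF L])
    fix h :: real assume "h \<ge> 0"
    show "AE x in distr M borel (L h). 0 \<le> x"
    proof (cases "h = 0")
      case True
      have "AE \<omega> in M. L 0 \<omega> = 0" using L by (simp add: levy_process_def)
      then have "AE \<omega> in M. 0 \<le> L 0 \<omega>" by eventually_elim simp
      then show ?thesis using True by (subst AE_distr_iff) (auto intro: L_meas)
    next
      case False
      then have "cts_law \<alpha> (\<beta> / 1) (h / T * c * 1 powr \<alpha>) (distr M borel (\<lambda>\<omega>. 1 * L h \<omega>))"
        using \<open>h \<ge> 0\<close> by (intro law) auto
      then show ?thesis using cts_law_nonneg by simp
    qed
  qed
  \<comment> \<open>The time at which \<open>a * L s1\<close> has the law required of \<open>X1\<close>.\<close>
  define s1 where "s1 = powr_primitive \<alpha> (1 / a) / (b * a powr \<alpha>)"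
  define c1 where "c1 = c * OU_CTS_factor a \<alpha> / (T * b)"
  have s1: "s1 > 0" unfolding s1_def using powr_primitive_pos[of "1 / a" \<alpha>] a b by auto
  have c1: "s1 / T * c * a powr \<alpha> = c1"
    unfolding s1_def c1_def OU_CTS_factor_eq[OF a(1)] using a by (simp add: mult_ac)
  define \<mu>1 where "\<mu>1 = distr M borel (\<lambda>\<omega>. a * L s1 \<omega>)"
  have \<mu>1: "cts_law \<alpha> (\<beta> / a) c1 \<mu>1"
    unfolding \<mu>1_def c1[symmetric] by (rule law[OF s1 a(1)])
  define \<Lambda> where "\<Lambda> = OU_CTS_rate T b \<beta> c a \<alpha>"
  define f where "f = OU_CTS_jump_density \<beta> a \<alpha>"
  have pos: "Gamma (1 - \<alpha>) > 0" "jump_weight \<alpha> a > 0"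
    using \<alpha> jump_weight_pos[OF a] by (auto intro: Gamma_real_pos)
  have \<Lambda>: "\<Lambda> > 0"
    unfolding \<Lambda>_def OU_CTS_rate_eq[OF a(1) \<beta>] using pos c \<beta> T b by simp
  have f_eq: "f x = \<beta> powr (1 - \<alpha>) / (Gamma (1 - \<alpha>) * jump_weight \<alpha> a) * jump_shape \<alpha> \<beta> a x" for x
    unfolding f_def by (rule OU_CTS_jump_density_eq[OF a \<beta>])
  have f_meas: "f \<in> borel_measurable borel" unfolding f_eq[abs_def] by measurable
  have f_nn: "f x \<ge> 0" for x unfolding f_eq using pos jump_shape_nonneg by simp
  have f_prob: "prob_space (density lborel (\<lambda>x. ennreal (f x)))"
    unfolding f_def by (rule OU_CTS_jump_density_prob_space[OF a \<beta> \<alpha>(2)])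
  have \<Lambda>f: "\<Lambda> * f x = (1 / (T * b)) * (c * \<beta> * jump_shape \<alpha> \<beta> a x)" for x
  proof -
    have "\<beta> powr \<alpha> * \<beta> powr (1 - \<alpha>) = \<beta>" using \<beta> by (simp add: powr_add[symmetric])
    moreover have "\<Lambda> * f x = (\<beta> powr \<alpha> * \<beta> powr (1 - \<alpha>)) * (c / (T * b) * jump_shape \<alpha> \<beta> a x)"
      unfolding \<Lambda>_def OU_CTS_rate_eq[OF a(1) \<beta>] f_eq using pos by (simp add: divide_simps mult_ac)
    ultimately show ?thesis by simp
  qed
  have r0: "real_distribution (distr M borel X0)" by auto
  have r1: "real_distribution \<mu>1" using \<mu>1 by (simp add: cts_law_def)
  from compound_poisson_exists[OF r0 r1 \<Lambda> f_meas f_prob]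
  obtain P :: "(nat \<Rightarrow> real) measure" and X0' X1 X2 N J where P: "prob_space P"
    and ind: "prob_space.indep_vars P (\<lambda>_. borel) (\<lambda>i. [X0', X1, X2] ! i) {..<3}"
    and d0: "distr P borel X0' = distr M borel X0" and d1: "distr P borel X1 = \<mu>1"
    and cp: "compound_poisson P \<Lambda> f N J X2"
    by blast
  interpret P: prob_space P by fact
  have meas: "[X0', X1, X2] ! i \<in> borel_measurable P" if "i < 3" for i
    using ind that by (auto simp: P.indep_vars_def)
  have [measurable]: "X0' \<in> borel_measurable P" "X1 \<in> borel_measurable P" "X2 \<in> borel_measurable P"
    using meas[of 0] meas[of 1] meas[of 2] by (simp_all add: numeral_2_eq_2)
  have "distr M borel (X t) = distr P borel (\<lambda>\<omega>. a * X0' \<omega> + X1 \<omega> + X2 \<omega>)"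
  proof (rule Levy_uniqueness)
    have "X t \<in> borel_measurable M" using assms(12) t unfolding OU_solution_def by simp
    then show "real_distribution (distr M borel (X t))" by auto
    show "real_distribution (distr P borel (\<lambda>\<omega>. a * X0' \<omega> + X1 \<omega> + X2 \<omega>))" by auto
    show "char (distr M borel (X t)) = char (distr P borel (\<lambda>\<omega>. a * X0' \<omega> + X1 \<omega> + X2 \<omega>))"
    proof
      fix u :: real
      \<comment> \<open>Only the initial value is multiplied by \<open>a\<close> in the sum.\<close>
      define A where "A = (\<lambda>i::nat. if i = 0 then a else 1)"
      have "P.indep_vars (\<lambda>_. borel) (\<lambda>i \<omega>. A i * ([X0', X1, X2] ! i) \<omega>) {..<3}"
        by (rule P.indep_vars_compose2[OF ind]) auto
      then have "char (distr P borel (\<lambda>\<omega>. \<Sum>i<3. A i * ([X0', X1, X2] ! i) \<omega>)) u =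
          (\<Prod>i<3. char (distr P borel (\<lambda>\<omega>. A i * ([X0', X1, X2] ! i) \<omega>)) u)"
        by (rule P.char_distr_sum)
      then have "char (distr P borel (\<lambda>\<omega>. a * X0' \<omega> + X1 \<omega> + X2 \<omega>)) u =
         char (distr P borel (\<lambda>\<omega>. a * X0' \<omega>)) u * char (distr P borel X1) u * char (distr P borel X2) u"
        by (simp add: A_def numeral_3_eq_3)
      also have "char (distr P borel (\<lambda>\<omega>. a * X0' \<omega>)) u = char (distr M borel X0) (a * u)"
        unfolding char_distr_scale[OF \<open>X0' \<in> borel_measurable P\<close>] d0 ..
      also have "char (distr P borel X1) u = exp (levy_exponent (cts_levy_density \<alpha> (\<beta> / a) c1) u)"
        using \<mu>1 unfolding d1 by (simp add: cts_law_def levy_exponent_def)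
      also have "char (distr P borel X2) u = exp (levy_exponent (\<lambda>x. \<Lambda> * f x) u)"
        unfolding char_compound_poisson(1)[OF P cp] levy_exponent_scale
          levy_exponent_prob_density[OF f_meas f_nn f_prob] ..
      finally have rhs: "char (distr P borel (\<lambda>\<omega>. a * X0' \<omega> + X1 \<omega> + X2 \<omega>)) u =
         char (distr M borel X0) (a * u) *
         exp (levy_exponent (cts_levy_density \<alpha> (\<beta> / a) c1) u + levy_exponent (\<lambda>x. \<Lambda> * f x) u)"
        by (simp add: exp_add mult.assoc)
      have lhs: "char (distr M borel (X t)) u = char (distr M borel X0) (u * a) *
          exp (complex_of_real (1 / T) * (CLINT s:{0..t}|lborel. \<psi> (u * exp (- b * (t - s)))))"
        unfolding a_def
        by (rule OU_solution_char[OF L b T t paths X0 assms(11,12) char_L \<psi>_cont])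
      have "complex_of_real (1 / T) * (CLINT s:{0..t}|lborel. \<psi> (u * exp (- b * (t - s)))) =
        complex_of_real (1 / (T * b)) * (complex_of_real b * (CLINT s:{0..t}|lborel. \<psi> (u * exp (- b * (t - s)))))"
        using b by simp
      also have "\<dots> = complex_of_real (1 / (T * b)) * (levy_exponent (cts_levy_density \<alpha> (\<beta> / a) (c * powr_primitive \<alpha> (1 / a))) u +
         levy_exponent (\<lambda>x. c * \<beta> * jump_shape \<alpha> \<beta> a x) u)"
        unfolding \<psi>_def time_integral_of_exponent[OF b t \<alpha> \<beta> c a_def] ..
      also have "\<dots> = levy_exponent (\<lambda>x. (1 / (T * b)) * cts_levy_density \<alpha> (\<beta> / a) (c * powr_primitive \<alpha> (1 / a)) x) u +
         levy_exponent (\<lambda>x. (1 / (T * b)) * (c * \<beta> * jump_shape \<alpha> \<beta> a x)) u"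
        unfolding levy_exponent_scale distrib_left ..
      also have "(\<lambda>x. (1 / (T * b)) * cts_levy_density \<alpha> (\<beta> / a) (c * powr_primitive \<alpha> (1 / a)) x) = cts_levy_density \<alpha> (\<beta> / a) c1"
        unfolding cts_levy_density_scale[symmetric] c1_def OU_CTS_factor_eq[OF a(1)] by simp
      finally show "char (distr M borel (X t)) u = char (distr P borel (\<lambda>\<omega>. a * X0' \<omega> + X1 \<omega> + X2 \<omega>)) u"
        unfolding lhs rhs \<Lambda>f by (simp only: mult.commute[of u a])
    qed
  qed
  then show ?thesis
    using P ind d0 d1 \<mu>1 cp unfolding c1_def \<Lambda>_def f_def by blast
qed

end
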